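(* Let $(Q_1,N_1)$ and $(Q_2,N_2)$ be two classical solutions of system (S) (with possibly different initial data). Then, for every $\tau\ge0$ such that both classical solutions exist up to time $\tau$, $$e^{k_{\min}\tau}\|\partial_\eta Q_1(0)-\partial_\eta Q_2(0)\|_{L^1(0,1)}\le\|\partial_\eta Q_1(\tau)-\partial_\eta Q_2(\tau)\|_{L^1(0,1)}\le e^{k_{\max}\tau}\|\partial_\eta Q_1(0)-\partial_\eta Q_2(0)\|_{L^1(0,1)},$$ where $$k_{\min}:=K'(0)+\int_0^{\Phi_F}(K''(\phi))_-\,d\phi,\qquad k_{\max}:=K'(0)+\int_0^{\Phi_F}(K''(\phi))_+\,d\phi .$$
   Context: Standing assumptions: $\Phi_F>0$ is fixed and $K\in C^2(\mathbb{R})$ is a function with $K',K''$ bounded on $\mathbb{R}$ and $K(\phi)>0$ for $\phi\in[0,\Phi_F]$. Notation: $(x)_-:=\min(x,0)$, $(x)_+:=\max(x,0)$; $\partial_\eta Q_i(\tau)$ denotes the function $\eta\mapsto\partial_\eta Q_i(\tau,\eta)$. System (S), for unknowns $Q(\tau,\eta)$ and $N(\tau)$: $$\partial_\tau Q+\partial_\eta Q=\frac1{N(\tau)}+K(Q)\quad(\tau>0,\ \eta\in(0,1)),\qquad Q(\tau,0)=0\quad(\tau>0),$$ $$\frac1{N(\tau)}=\partial_\eta Q(\tau,1)-K(\Phi_F)\quad(\tau>0),\qquad Q(0,\eta)=Q_{\mathrm{init}}(\eta)\quad(\eta\in[0,1]).$$ Classical solution: given $0<T\le+\infty$ and an initial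 datum $Q_{\mathrm{init}}\in C^1[0,1]$ that is increasing with $Q_{\mathrm{init}}(0)=0$, $Q_{\mathrm{init}}(1)=\Phi_F$ and $\frac{d}{d\eta}Q_{\mathrm{init}}(1)>K(\Phi_F)$, a pair $(Q,N)$ is a classical solution of (S) on $[0,T)$ if (1) $Q\in C^1([0,T)\times[0,1])$ is increasing in $\eta$ and $N\in C[0,T)$ is positive; (2) the equations of (S) hold in the classical sense for $\tau\in[0,T)$; (3) $K(\Phi_F)<\partial_\eta Q(\tau,1)<+\infty$ for all $\tau\in[0,T)$. Here "increasing" means non-decreasing. *)

theory Defs
  imports "HOL-Analysis.Analysis"
begin

text \<open>
  \<open>C\<^sup>1\<close> up to the boundary: at boundary points of \<^term>\<open>S\<close> the derivative is the one
  relative to \<^term>\<open>S\<close>.  It is only used for \<open>[0,1]\<close> and \<open>[0,T) \<times> [0,1]\<close>, where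
  this derivative is unique.  (\<^const>\<open>C1_differentiable_on\<close> demands two-sided derivatives
  even at the endpoints and covers only functions of one real variable.)
\<close>

definition C1_on :: "'a set \<Rightarrow> ('a::real_normed_vector \<Rightarrow> 'b::real_normed_vector) \<Rightarrow> bool" where
  "C1_on S f \<longleftrightarrow>
     (\<exists>D :: 'a \<Rightarrow> 'a \<Rightarrow>\<^sub>L 'b. continuous_on S D \<and>
        (\<forall>x\<in>S. (f has_derivative blinfun_apply (D x)) (at x within S)))"

definition C2_real :: "(real \<Rightarrow> real) \<Rightarrow> bool" where
  "C2_real f \<longleftrightarrow>
     (\<forall>x. f differentiable (at x)) \<and>
     (\<forall>x. deriv f differentiable (at x)) \<and>
     continuous_on UNIV (deriv (deriv f))"

definition neg_part :: "real \<Rightarrow> real" where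
  "neg_part x = min x 0"

definition pos_part :: "real \<Rightarrow> real" where
  "pos_part x = max x 0"

definition k_min :: "(real \<Rightarrow> real) \<Rightarrow> real \<Rightarrow> real" where
  "k_min K \<Phi> = deriv K 0 + (LBINT \<phi>:{0..\<Phi>}. neg_part (deriv (deriv K) \<phi>))"

definition k_max :: "(real \<Rightarrow> real) \<Rightarrow> real \<Rightarrow> real" where
  "k_max K \<Phi> = deriv K 0 + (LBINT \<phi>:{0..\<Phi>}. pos_part (deriv (deriv K) \<phi>))"

definition L1_norm :: "(real \<Rightarrow> real) \<Rightarrow> real" where
  "L1_norm f = (LBINT \<eta>:{0<..<1}. \<bar>f \<eta>\<bar>)"

definition standing_assumptions :: "(real \<Rightarrow> real) \<Rightarrow> real \<Rightarrow> bool" where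
  "standing_assumptions K \<Phi> \<longleftrightarrow>
     0 < \<Phi> \<and> C2_real K \<and>
     bounded (range (deriv K)) \<and> bounded (range (deriv (deriv K))) \<and>
     (\<forall>\<phi>\<in>{0..\<Phi>}. 0 < K \<phi>)"

text \<open>The interval \<open>[0,T)\<close>, where \<open>T = \<infinity>\<close> is allowed.\<close>

definition time_dom :: "ereal \<Rightarrow> real set" where
  "time_dom T = {\<tau>. 0 \<le> \<tau> \<and> ereal \<tau> < T}"

text \<open>Partial derivatives; they are one-sided at \<open>\<tau> = 0\<close>, \<open>\<eta> = 0\<close> and \<open>\<eta> = 1\<close>.\<close>

definition d_eta :: "(real \<Rightarrow> real \<Rightarrow> real) \<Rightarrow> real \<Rightarrow> real \<Rightarrow> real" where
  "d_eta Q \<tau> \<eta> = vector_derivative (\<lambda>e. Q \<tau> e) (at \<eta> within {0..1})"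

definition d_tau :: "ereal \<Rightarrow> (real \<Rightarrow> real \<Rightarrow> real) \<Rightarrow> real \<Rightarrow> real \<Rightarrow> real" where
  "d_tau T Q \<tau> \<eta> = vector_derivative (\<lambda>s. Q s \<eta>) (at \<tau> within time_dom T)"

definition admissible_datum :: "(real \<Rightarrow> real) \<Rightarrow> real \<Rightarrow> (real \<Rightarrow> real) \<Rightarrow> bool" where
  "admissible_datum K \<Phi> Qinit \<longleftrightarrow>
     C1_on {0..1} Qinit \<and> mono_on {0..1} Qinit \<and>
     Qinit 0 = 0 \<and> Qinit 1 = \<Phi> \<and>
     vector_derivative Qinit (at 1 within {0..1}) > K \<Phi>"

definition satisfies_system ::
  "(real \<Rightarrow> real) \<Rightarrow> real \<Rightarrow> ereal \<Rightarrow> (real \<Rightarrow> real) \<Rightarrow>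
   (real \<Rightarrow> real \<Rightarrow> real) \<Rightarrow> (real \<Rightarrow> real) \<Rightarrow> bool" where
  "satisfies_system K \<Phi> T Qinit Q N \<longleftrightarrow>
     (\<forall>\<tau>\<in>time_dom T. \<forall>\<eta>\<in>{0<..<1}.
        d_tau T Q \<tau> \<eta> + d_eta Q \<tau> \<eta> = 1 / N \<tau> + K (Q \<tau> \<eta>)) \<and>
     (\<forall>\<tau>\<in>time_dom T. Q \<tau> 0 = 0) \<and>
     (\<forall>\<tau>\<in>time_dom T. 1 / N \<tau> = d_eta Q \<tau> 1 - K \<Phi>) \<and>
     (\<forall>\<eta>\<in>{0..1}. Q 0 \<eta> = Qinit \<eta>)"

text \<open>The bound \<open>\<partial>\<^sub>\<eta>Q(\<tau>,1) < +\<infinity>\<close> is implicit in the real-valuedness of the derivative.\<close>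

definition classical_solution ::
  "(real \<Rightarrow> real) \<Rightarrow> real \<Rightarrow> ereal \<Rightarrow> (real \<Rightarrow> real) \<Rightarrow>
   (real \<Rightarrow> real \<Rightarrow> real) \<Rightarrow> (real \<Rightarrow> real) \<Rightarrow> bool" where
  "classical_solution K \<Phi> T Qinit Q N \<longleftrightarrow>
     0 < T \<and> admissible_datum K \<Phi> Qinit \<and>
     C1_on (time_dom T \<times> {0..1}) (\<lambda>(\<tau>, \<eta>). Q \<tau> \<eta>) \<and>
     (\<forall>\<tau>\<in>time_dom T. mono_on {0..1} (Q \<tau>)) \<and>
     continuous_on (time_dom T) N \<and> (\<forall>\<tau>\<in>time_dom T. 0 < N \<tau>) \<and>
     satisfies_system K \<Phi> T Qinit Q N \<and>
     (\<forall>\<tau>\<in>time_dom T. K \<Phi> < d_eta Q \<tau> 1)"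

end

theory Submission
  imports Defs
begin

text \<open>
Write \<open>q\<^sub>i = \<partial>\<^sub>\<eta>Q\<^sub>i\<close> and \<open>w = q\<^sub>1 - q\<^sub>2\<close>.  Differentiating the equation in \<open>\<eta>\<close> removes the
nonlocal source \<open>1/N\<close> and leaves \<open>\<partial>\<^sub>\<tau>q\<^sub>i + \<partial>\<^sub>\<eta>q\<^sub>i = K'(Q\<^sub>i) q\<^sub>i\<close>.  The boundary conditions force
\<open>Q\<^sub>i(\<tau>,1) = \<Phi>\<close> and \<open>q\<^sub>i(\<tau>,0) = q\<^sub>i(\<tau>,1) - K(\<Phi>) + K(0)\<close>, so \<open>w\<close> is periodic: \<open>w(\<tau>,0) = w(\<tau>,1)\<close>.
Hence \<open>w\<close> is transported around a circle with source \<open>g = K'(Q\<^sub>1) q\<^sub>1 - K'(Q\<^sub>2) q\<^sub>2\<close>, and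
\[ \frac{d}{d\tau} \int_0^1 |w| = \int_0^1 \mathrm{sgn}(w)\, g . \]
It remains to see that the right-hand side lies between \<open>k\<^sub>m\<^sub>i\<^sub>n \<integral>\<bar>w\<bar>\<close> and \<open>k\<^sub>m\<^sub>a\<^sub>x \<integral>\<bar>w\<bar>\<close>.

This last point is an inequality at a fixed time (\<open>integral_sgn_weighted_bounds\<close>).  Suppose \<open>B = A'\<close>
is increasing and positive and replaces \<open>K'\<close>.  With \<open>p = sgn (Q\<^sub>1 - Q\<^sub>2)\<close> and \<open>m = min(Q\<^sub>1,Q\<^sub>2)\<close>,
and because \<open>q\<^sub>i \<ge> 0\<close>,
\[ B(m)(|w| + p w) - p\,\partial_\eta(A(Q_1) - A(Q_2)) \le \mathrm{sgn}(w)\,(B(Q_1)q_1 - B(Q_2)q_2)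
   \le B(m)(|w| - p w) + p\,\partial_\eta(A(Q_1) - A(Q_2)) . \]
Now \<open>p \<partial>\<^sub>\<eta>(A(Q\<^sub>1) - A(Q\<^sub>2))\<close> and \<open>p w\<close> are the derivatives of \<open>\<bar>A(Q\<^sub>1) - A(Q\<^sub>2)\<bar>\<close> and \<open>\<bar>Q\<^sub>1 - Q\<^sub>2\<bar>\<close>,
which vanish at both ends, so both integrate to zero; since \<open>B(0) \<le> B(m) \<le> B(\<Phi>)\<close>, the integral lies
between \<open>B(0) \<integral>\<bar>w\<bar>\<close> and \<open>B(\<Phi>) \<integral>\<bar>w\<bar>\<close>.  Splitting \<open>K'\<close> into \<open>K'(0)\<close> plus the difference of two such
functions, \<open>1 + \<integral>\<^sub>0 (K'')\<^sub>+\<close> and \<open>1 - \<integral>\<^sub>0 (K'')\<^sub>-\<close>, gives exactly \<open>k\<^sub>m\<^sub>i\<^sub>n\<close> and \<open>k\<^sub>m\<^sub>a\<^sub>x\<close>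
(\<open>integral_sgn_growth_bounds\<close>).

The functions \<open>q\<^sub>i\<close> are merely continuous, so the transport equation is used only along
characteristics (\<open>q_along_characteristic\<close>), and the identity for \<open>\<integral>\<bar>w\<bar>\<close> is proved in integrated form
with Fubini's theorem (\<open>transport_L1_identity\<close>).  Applied to \<open>e\<^sup>-\<^sup>k\<^sup>\<tau> w\<close> in place of \<open>w\<close>, it shows that
\<open>e\<^sup>-\<^sup>k\<^sup>\<tau> \<integral>\<bar>w\<bar>\<close> is monotone, which is the claim (\<open>transport_L1_exp_bounds\<close>).
\<close>

section \<open>The sign of a function as an integration weight\<close>

text \<open>
The sign function is discontinuous, so \<open>sgn f\<close> is replaced by the smooth \<open>f / sqrt (f\<^sup>2 + \<epsilon>)\<close>,
which is bounded by 1 and converges to \<open>sgn f\<close> pointwise, also at the zeros of \<open>f\<close>; dominated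
convergence does the rest.
\<close>

lemma sgn_mult_integral_approx:
  fixes f h :: "real \<Rightarrow> real"
  assumes contf: "continuous_on {a..b} f" and conth: "continuous_on {a..b} h"
  shows "(\<lambda>x. sgn (f x) * h x) integrable_on {a..b}"
    and "(\<lambda>n. integral {a..b} (\<lambda>x. f x / sqrt ((f x)\<^sup>2 + inverse (real (Suc n))) * h x))
           \<longlonglongrightarrow> integral {a..b} (\<lambda>x. sgn (f x) * h x)"
proof -
  define e where "e n = inverse (real (Suc n))" for n
  have e: "0 < e n" for n by (simp add: e_def)
  have e0: "e \<longlonglongrightarrow> 0" unfolding e_def by (rule LIMSEQ_inverse_real_of_nat)
  define F where "F n x = f x / sqrt ((f x)\<^sup>2 + e n) * h x" for n x
  have pos: "0 < (f x)\<^sup>2 + e n" for n x using e[of n] by (simp add: add_nonneg_pos)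
  have int: "F n integrable_on {a..b}" for n
  proof (rule integrable_continuous_real)
    have "sqrt ((f x)\<^sup>2 + e n) \<noteq> 0" for x using pos[of x n] by simp
    then show "continuous_on {a..b} (F n)"
      unfolding F_def by (intro continuous_intros contf conth) simp
  qed
  have bnd: "norm (F n x) \<le> \<bar>h x\<bar>" for n x
  proof -
    have "\<bar>f x\<bar> \<le> sqrt ((f x)\<^sup>2 + e n)" using e[of n] by (simp add: real_le_rsqrt)
    then have "\<bar>f x / sqrt ((f x)\<^sup>2 + e n)\<bar> \<le> 1" using pos[of x n] by (simp add: abs_divide)
    then have "\<bar>f x / sqrt ((f x)\<^sup>2 + e n)\<bar> * \<bar>h x\<bar> \<le> 1 * \<bar>h x\<bar>"
      by (rule mult_right_mono) simp
    then show ?thesis unfolding F_def real_norm_def by (simp only: abs_mult mult_1)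
  qed
  have lim: "(\<lambda>n. F n x) \<longlonglongrightarrow> sgn (f x) * h x" for x
  proof (cases "f x = 0")
    case False
    have "(\<lambda>n. sqrt ((f x)\<^sup>2 + e n)) \<longlonglongrightarrow> sqrt ((f x)\<^sup>2 + 0)"
      by (intro tendsto_intros e0)
    then have "(\<lambda>n. F n x) \<longlonglongrightarrow> f x / \<bar>f x\<bar> * h x"
      unfolding F_def by (intro tendsto_intros) (use False in simp_all)
    then show ?thesis by (simp add: sgn_div_norm divide_inverse mult.commute sgn_if False abs_if)
  qed (simp add: F_def)
  have dom: "(\<lambda>x. \<bar>h x\<bar>) integrable_on {a..b}"
    by (intro integrable_continuous_real continuous_intros conth)
  show "(\<lambda>x. sgn (f x) * h x) integrable_on {a..b}"
    and "(\<lambda>n. integral {a..b} (\<lambda>x. f x / sqrt ((f x)\<^sup>2 + inverse (real (Suc n))) * h x))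
           \<longlonglongrightarrow> integral {a..b} (\<lambda>x. sgn (f x) * h x)"
    using dominated_convergence[OF int dom bnd lim] by (simp_all add: F_def e_def)
qed

text \<open>
The absolute value \<open>\<bar>f\<bar>\<close> need not be differentiable at the zeros of \<open>f\<close>, but it is the limit of
\<open>sqrt (f\<^sup>2 + \<epsilon>)\<close>, whose derivative is the smooth approximation of \<open>sgn f * f'\<close> used above.
\<close>

lemma has_integral_sgn_mult_deriv:
  fixes f f' :: "real \<Rightarrow> real"
  assumes ab: "a \<le> b"
    and der: "\<And>x. x \<in> {a..b} \<Longrightarrow> (f has_real_derivative f' x) (at x within {a..b})"
    and cont: "continuous_on {a..b} f'"
  shows "((\<lambda>x. sgn (f x) * f' x) has_integral (\<bar>f b\<bar> - \<bar>f a\<bar>)) {a..b}"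
proof -
  define e where "e n = inverse (real (Suc n))" for n
  have e: "0 < e n" for n by (simp add: e_def)
  have e0: "e \<longlonglongrightarrow> 0" unfolding e_def by (rule LIMSEQ_inverse_real_of_nat)
  have contf: "continuous_on {a..b} f"
    by (rule DERIV_continuous_on[OF der])
  have lim_sqrt: "(\<lambda>n. sqrt (y\<^sup>2 + e n)) \<longlonglongrightarrow> \<bar>y\<bar>" for y
  proof -
    have "(\<lambda>n. sqrt (y\<^sup>2 + e n)) \<longlonglongrightarrow> sqrt (y\<^sup>2 + 0)"
      by (intro tendsto_intros e0)
    then show ?thesis by simp
  qed
  have "((\<lambda>x. f x / sqrt ((f x)\<^sup>2 + e n) * f' x) has_integral
      (sqrt ((f b)\<^sup>2 + e n) - sqrt ((f a)\<^sup>2 + e n))) {a..b}" for n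
  proof (rule fundamental_theorem_of_calculus[OF ab])
    fix x assume x: "x \<in> {a..b}"
    have pos: "0 < (f x)\<^sup>2 + e n" using e[of n] by (simp add: add_nonneg_pos)
    have "((\<lambda>x. (f x)\<^sup>2 + e n) has_real_derivative 2 * f x * f' x) (at x within {a..b})"
      by (rule derivative_eq_intros der[OF x] refl | simp)+
    from DERIV_chain2[OF DERIV_real_sqrt[OF pos] this]
    have "((\<lambda>x. sqrt ((f x)\<^sup>2 + e n)) has_real_derivative f x / sqrt ((f x)\<^sup>2 + e n) * f' x)
        (at x within {a..b})"
      by (rule DERIV_cong) (simp add: field_simps)
    then show "((\<lambda>x. sqrt ((f x)\<^sup>2 + e n)) has_vector_derivative f x / sqrt ((f x)\<^sup>2 + e n) * f' x)
        (at x within {a..b})"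
      by (simp only: has_real_derivative_iff_has_vector_derivative)
  qed
  then have "integral {a..b} (\<lambda>x. f x / sqrt ((f x)\<^sup>2 + e n) * f' x) =
      sqrt ((f b)\<^sup>2 + e n) - sqrt ((f a)\<^sup>2 + e n)" for n
    by (rule integral_unique)
  moreover have "(\<lambda>n. sqrt ((f b)\<^sup>2 + e n) - sqrt ((f a)\<^sup>2 + e n)) \<longlonglongrightarrow> \<bar>f b\<bar> - \<bar>f a\<bar>"
    by (intro tendsto_diff lim_sqrt)
  ultimately have "integral {a..b} (\<lambda>x. sgn (f x) * f' x) = \<bar>f b\<bar> - \<bar>f a\<bar>"
    using LIMSEQ_unique sgn_mult_integral_approx(2)[OF contf cont] by (simp add: e_def)
  with sgn_mult_integral_approx(1)[OF contf cont] show ?thesis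
    by (simp add: has_integral_iff)
qed

text \<open>
For increasing weights \<open>B\<close> the growth rate lies between the extreme values of \<open>B\<close>.  Positivity of
\<open>B\<close> makes \<open>A\<close> strictly increasing, so that \<open>A(u\<^sub>1) - A(u\<^sub>2)\<close> has the same sign as \<open>u\<^sub>1 - u\<^sub>2\<close> and one
sign function \<open>p\<close> serves both differences.
\<close>

lemma integral_sgn_weighted_bounds:
  fixes u\<^sub>1 u\<^sub>2 v\<^sub>1 v\<^sub>2 A B :: "real \<Rightarrow> real"
  assumes ab: "a \<le> b" and cd: "c \<le> d"
    and der1: "\<And>x. x \<in> {a..b} \<Longrightarrow> (u\<^sub>1 has_real_derivative v\<^sub>1 x) (at x within {a..b})"
    and der2: "\<And>x. x \<in> {a..b} \<Longrightarrow> (u\<^sub>2 has_real_derivative v\<^sub>2 x) (at x within {a..b})"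
    and cont1: "continuous_on {a..b} v\<^sub>1" and cont2: "continuous_on {a..b} v\<^sub>2"
    and nn1: "\<And>x. x \<in> {a..b} \<Longrightarrow> 0 \<le> v\<^sub>1 x" and nn2: "\<And>x. x \<in> {a..b} \<Longrightarrow> 0 \<le> v\<^sub>2 x"
    and ran1: "\<And>x. x \<in> {a..b} \<Longrightarrow> u\<^sub>1 x \<in> {c..d}" and ran2: "\<And>x. x \<in> {a..b} \<Longrightarrow> u\<^sub>2 x \<in> {c..d}"
    and eqa: "u\<^sub>1 a = u\<^sub>2 a" and eqb: "u\<^sub>1 b = u\<^sub>2 b"
    and derA: "\<And>y. y \<in> {c..d} \<Longrightarrow> (A has_real_derivative B y) (at y within {c..d})"
    and contB: "continuous_on {c..d} B" and monoB: "mono_on {c..d} B" and posB: "0 < B c"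
  shows "B c * integral {a..b} (\<lambda>x. \<bar>v\<^sub>1 x - v\<^sub>2 x\<bar>)
           \<le> integral {a..b} (\<lambda>x. sgn (v\<^sub>1 x - v\<^sub>2 x) * (B (u\<^sub>1 x) * v\<^sub>1 x - B (u\<^sub>2 x) * v\<^sub>2 x))" (is ?lower)
    and "integral {a..b} (\<lambda>x. sgn (v\<^sub>1 x - v\<^sub>2 x) * (B (u\<^sub>1 x) * v\<^sub>1 x - B (u\<^sub>2 x) * v\<^sub>2 x))
           \<le> B d * integral {a..b} (\<lambda>x. \<bar>v\<^sub>1 x - v\<^sub>2 x\<bar>)" (is ?upper)
proof -
  define w where "w x = v\<^sub>1 x - v\<^sub>2 x" for x
  define p where "p x = sgn (u\<^sub>1 x - u\<^sub>2 x)" for x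
  define g where "g x = B (u\<^sub>1 x) * v\<^sub>1 x - B (u\<^sub>2 x) * v\<^sub>2 x" for x
  have B: "B c \<le> B y" "B y \<le> B d" "0 < B y" if "y \<in> {c..d}" for y
    using that posB monoB cd
    by (auto simp: monotone_on_def) (smt (verit) atLeastAtMost_iff)
  have A: "A y < A z" if "y \<in> {c..d}" "z \<in> {c..d}" "y < z" for y z
  proof (rule DERIV_pos_imp_increasing_open[OF \<open>y < z\<close>])
    fix x assume x: "y < x" "x < z"
    have "(A has_real_derivative B x) (at x)"
      using derA[of x] x that at_within_Icc_at[of c x d] by auto
    then show "\<exists>D. (A has_real_derivative D) (at x) \<and> 0 < D"
      using B(3)[of x] x that by auto
  next
    have "continuous_on {c..d} A" by (rule DERIV_continuous_on[OF derA])
    then show "continuous_on {y..z} A" by (rule continuous_on_subset) (use that in auto)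
  qed
  have sgnA: "sgn (A y - A z) = sgn (y - z)" if "y \<in> {c..d}" "z \<in> {c..d}" for y z
    using A[of y z] A[of z y] that by (cases y z rule: linorder_cases) auto
  have cu: "continuous_on {a..b} u\<^sub>1" "continuous_on {a..b} u\<^sub>2"
    by (rule DERIV_continuous_on[OF der1], assumption) (rule DERIV_continuous_on[OF der2], assumption)
  have ran: "u\<^sub>1 ` {a..b} \<subseteq> {c..d}" "u\<^sub>2 ` {a..b} \<subseteq> {c..d}" using ran1 ran2 by auto
  have cB: "continuous_on {a..b} (\<lambda>x. B (u\<^sub>1 x))" "continuous_on {a..b} (\<lambda>x. B (u\<^sub>2 x))"
    using continuous_on_compose2[OF contB cu(1) ran(1)] continuous_on_compose2[OF contB cu(2) ran(2)] .
  have 1: "((\<lambda>x. p x * w x) has_integral 0) {a..b}"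
  proof -
    have "((\<lambda>x. sgn (u\<^sub>1 x - u\<^sub>2 x) * w x) has_integral (\<bar>u\<^sub>1 b - u\<^sub>2 b\<bar> - \<bar>u\<^sub>1 a - u\<^sub>2 a\<bar>)) {a..b}"
      unfolding w_def
      by (rule has_integral_sgn_mult_deriv[OF ab])
        (auto intro!: DERIV_diff der1 der2 continuous_intros cont1 cont2)
    then show ?thesis by (simp add: p_def eqa eqb)
  qed
  have 2: "((\<lambda>x. p x * g x) has_integral 0) {a..b}"
  proof -
    have "((\<lambda>x. sgn (A (u\<^sub>1 x) - A (u\<^sub>2 x)) * g x) has_integral
        (\<bar>A (u\<^sub>1 b) - A (u\<^sub>2 b)\<bar> - \<bar>A (u\<^sub>1 a) - A (u\<^sub>2 a)\<bar>)) {a..b}"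
    proof (rule has_integral_sgn_mult_deriv[OF ab])
      fix x assume x: "x \<in> {a..b}"
      have "((\<lambda>x. A (u\<^sub>1 x)) has_real_derivative B (u\<^sub>1 x) * v\<^sub>1 x) (at x within {a..b})"
        using DERIV_image_chain[OF DERIV_subset[OF derA[OF ran1[OF x]] ran(1)] der1[OF x]] by (simp add: o_def)
      moreover have "((\<lambda>x. A (u\<^sub>2 x)) has_real_derivative B (u\<^sub>2 x) * v\<^sub>2 x) (at x within {a..b})"
        using DERIV_image_chain[OF DERIV_subset[OF derA[OF ran2[OF x]] ran(2)] der2[OF x]] by (simp add: o_def)
      ultimately show "((\<lambda>x. A (u\<^sub>1 x) - A (u\<^sub>2 x)) has_real_derivative g x) (at x within {a..b})"
        unfolding g_def by (rule DERIV_diff)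
    next
      show "continuous_on {a..b} g" unfolding g_def by (intro continuous_intros cB cont1 cont2)
    qed
    then have "((\<lambda>x. sgn (A (u\<^sub>1 x) - A (u\<^sub>2 x)) * g x) has_integral 0) {a..b}" by (simp add: eqa eqb)
    then show ?thesis
      by (rule has_integral_eq[rotated]) (simp only: p_def sgnA[OF ran1 ran2])
  qed
  have 3: "((\<lambda>x. \<bar>w x\<bar>) has_integral integral {a..b} (\<lambda>x. \<bar>w x\<bar>)) {a..b}"
    unfolding w_def
    by (intro integrable_integral integrable_continuous_real continuous_intros cont1 cont2)
  have 4: "((\<lambda>x. sgn (w x) * g x) has_integral integral {a..b} (\<lambda>x. sgn (w x) * g x)) {a..b}"
    unfolding w_def g_def
    by (intro integrable_integral sgn_mult_integral_approx(1) continuous_intros cB cont1 cont2)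
  have pt: "B c * (\<bar>w x\<bar> + p x * w x) - p x * g x \<le> sgn (w x) * g x"
      "sgn (w x) * g x \<le> B d * (\<bar>w x\<bar> - p x * w x) + p x * g x" if x: "x \<in> {a..b}" for x
  proof -
    define m where "m = min (u\<^sub>1 x) (u\<^sub>2 x)"
    have m: "m \<in> {c..d}" using ran1[OF x] ran2[OF x] by (auto simp: m_def min_def)
    have nn: "0 \<le> \<bar>w x\<bar> + p x * w x" "0 \<le> \<bar>w x\<bar> - p x * w x"
      by (auto simp: p_def sgn_if)
    \<comment> \<open>With \<open>u\<close>, \<open>v\<close> belonging to the larger of the two functions,
      \<open>g = B m * w + p * (B u - B m) * v\<close>, and the correction \<open>(B u - B m) * v\<close> is nonnegative.\<close>
    have key: "B m * (\<bar>w x\<bar> + p x * w x) - p x * g x \<le> sgn (w x) * g x \<and>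
      sgn (w x) * g x \<le> B m * (\<bar>w x\<bar> - p x * w x) + p x * g x"
    proof -
      have aux: "\<bar>s * t * y\<bar> \<le> t * y" if "0 \<le> t" "0 \<le> y" "\<bar>s\<bar> \<le> 1" for s t y :: real
        using that mult_right_mono[of "\<bar>s\<bar>" 1 "t * y"] by (simp add: abs_mult)
      have s: "sgn (w x) * w x = \<bar>w x\<bar>" "\<bar>sgn (w x)\<bar> \<le> 1" by (auto simp: sgn_if)
      consider "u\<^sub>1 x = u\<^sub>2 x" | "u\<^sub>2 x < u\<^sub>1 x" | "u\<^sub>1 x < u\<^sub>2 x" by linarith
      then show ?thesis
      proof cases
        case 1
        then have "g x = B m * w x" "p x = 0" by (simp_all add: g_def w_def m_def p_def algebra_simps)
        then show ?thesis using s by (simp add: algebra_simps)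
      next
        case 2
        then have "B (u\<^sub>2 x) \<le> B (u\<^sub>1 x)"
          using monoB ran1[OF x] ran2[OF x] by (auto simp: monotone_on_def)
        then have "\<bar>sgn (w x) * (B (u\<^sub>1 x) - B m) * v\<^sub>1 x\<bar> \<le> (B (u\<^sub>1 x) - B m) * v\<^sub>1 x"
          by (intro aux) (use 2 nn1[OF x] s in \<open>auto simp: m_def\<close>)
        moreover have g: "g x = B m * w x + (B (u\<^sub>1 x) - B m) * v\<^sub>1 x"
          using 2 by (simp add: g_def w_def m_def algebra_simps)
        moreover have "sgn (w x) * g x = B m * \<bar>w x\<bar> + sgn (w x) * (B (u\<^sub>1 x) - B m) * v\<^sub>1 x"
          unfolding g s(1)[symmetric] by (simp add: algebra_simps)
        moreover have pw: "p x * w x = w x" "p x * g x = g x" using 2 by (simp_all add: p_def)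
        ultimately show ?thesis
          unfolding pw abs_le_iff distrib_left[of "B m"] right_diff_distrib[of "B m"] mult_minus_right by linarith
      next
        case 3
        then have "B (u\<^sub>1 x) \<le> B (u\<^sub>2 x)"
          using monoB ran1[OF x] ran2[OF x] by (auto simp: monotone_on_def)
        then have "\<bar>sgn (w x) * (B (u\<^sub>2 x) - B m) * v\<^sub>2 x\<bar> \<le> (B (u\<^sub>2 x) - B m) * v\<^sub>2 x"
          by (intro aux) (use 3 nn2[OF x] s in \<open>auto simp: m_def\<close>)
        moreover have g: "g x = B m * w x - (B (u\<^sub>2 x) - B m) * v\<^sub>2 x"
          using 3 by (simp add: g_def w_def m_def algebra_simps)
        moreover have "sgn (w x) * g x = B m * \<bar>w x\<bar> - sgn (w x) * (B (u\<^sub>2 x) - B m) * v\<^sub>2 x"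
          unfolding g s(1)[symmetric] by (simp add: algebra_simps)
        moreover have pw: "p x * w x = -w x" "p x * g x = -g x" using 3 by (simp_all add: p_def)
        ultimately show ?thesis
          unfolding pw abs_le_iff distrib_left[of "B m"] right_diff_distrib[of "B m"] mult_minus_right by linarith
      qed
    qed
    show "B c * (\<bar>w x\<bar> + p x * w x) - p x * g x \<le> sgn (w x) * g x"
      using key mult_right_mono[OF B(1)[OF m] nn(1)] by linarith
    show "sgn (w x) * g x \<le> B d * (\<bar>w x\<bar> - p x * w x) + p x * g x"
      using key mult_right_mono[OF B(2)[OF m] nn(2)] by linarith
  qed
  have lo: "((\<lambda>x. B c * (\<bar>w x\<bar> + p x * w x) - p x * g x) has_integral
      B c * (integral {a..b} (\<lambda>x. \<bar>w x\<bar>) + 0) - 0) {a..b}"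
    by (intro has_integral_diff has_integral_mult_right has_integral_add 1 2 3)
  have hi: "((\<lambda>x. B d * (\<bar>w x\<bar> - p x * w x) + p x * g x) has_integral
      B d * (integral {a..b} (\<lambda>x. \<bar>w x\<bar>) - 0) + 0) {a..b}"
    by (intro has_integral_diff has_integral_mult_right has_integral_add 1 2 3)
  show ?lower using has_integral_le[OF lo 4 pt(1)] by (simp add: w_def g_def)
  show ?upper using has_integral_le[OF 4 hi pt(2)] by (simp add: w_def g_def)
qed

section \<open>Transport on the circle and the \<open>L\<^sup>1\<close> norm\<close>

lemma continuous_on_compose_Pair:
  assumes f: "continuous_on (S \<times> T) (\<lambda>(x, y). f x y)"
    and \<alpha>: "continuous_on I \<alpha>" and \<beta>: "continuous_on I \<beta>"
    and ran: "\<And>r. r \<in> I \<Longrightarrow> \<alpha> r \<in> S" "\<And>r. r \<in> I \<Longrightarrow> \<beta> r \<in> T"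
  shows "continuous_on I (\<lambda>r. f (\<alpha> r) (\<beta> r))"
  using continuous_on_compose2[OF f continuous_on_Pair[OF \<alpha> \<beta>]] ran by auto

lemma has_integral_rotate_unit_interval:
  fixes f :: "real \<Rightarrow> real"
  assumes f: "f integrable_on {0..1}" and c: "0 \<le> c" "c \<le> 1"
  shows "((\<lambda>x. f (if x + c \<le> 1 then x + c else x + c - 1)) has_integral integral {0..1} f) {0..1}"
proof -
  have 1: "(f has_integral integral {c..1} f) {c..1}" and 2: "(f has_integral integral {0..c} f) {0..c}"
    using c by (auto intro!: integrable_integral integrable_subinterval_real[OF f])
  have "((\<lambda>x. f (if x + c \<le> 1 then x + c else x + c - 1)) has_integral integral {c..1} f) {0..1-c}"
    by (rule has_integral_eq[rotated, OF has_integral_shift_Icc_real[of f c _ 0 "1 - c", THEN iffD2]])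
      (use 1 in \<open>auto simp: add.commute\<close>)
  moreover have "((\<lambda>x. f (if x + c \<le> 1 then x + c else x + c - 1)) has_integral integral {0..c} f) {1-c..1}"
    by (rule has_integral_spike_finite[of "{1-c}", OF _ _ has_integral_shift_Icc_real[of f "c - 1" _ "1 - c" 1, THEN iffD2]])
      (use 2 in \<open>auto simp: algebra_simps\<close>)
  ultimately have "((\<lambda>x. f (if x + c \<le> 1 then x + c else x + c - 1)) has_integral
      (integral {c..1} f + integral {0..c} f)) {0..1}"
    by (rule has_integral_combine[rotated 2]) (use c in auto)
  moreover have "integral {0..c} f + integral {c..1} f = integral {0..1} f"
    by (rule Henstock_Kurzweil_Integration.integral_combine) (use c f in auto)
  ultimately show ?thesis by (simp add: add.commute)
qed

lemma set_integrable_lborel_bounded: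
  fixes f :: "real \<Rightarrow> real"
  assumes [measurable]: "f \<in> borel_measurable borel" and bnd: "\<And>x. x \<in> {a..b} \<Longrightarrow> \<bar>f x\<bar> \<le> M"
  shows "set_integrable lborel {a..b} f"
  unfolding set_integrable_def
  by (rule integrableI_bounded_set_indicator[where B = M]) (use bnd in \<open>auto simp: emeasure_lborel_Icc_eq\<close>)

text \<open>
Follow each point \<open>x\<close> of the circle from time \<open>s\<close> to time \<open>t\<close> at unit speed.  On \<open>[0,1]\<close> its path consists
of one arc, or of two arcs joined at \<open>1 \<sim> 0\<close> where \<open>w\<close> takes the same value; \<open>t \<le> s + 1\<close> rules out
further wrapping.  Along the path \<open>\<bar>w\<bar>\<close> changes by the integral of \<open>sgn w * g\<close>.  Integrating over \<open>x\<close>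
and exchanging the integrals gives the identity, as rotations of the circle preserve integrals.
\<close>

lemma transport_L1_identity:
  fixes w g :: "real \<Rightarrow> real \<Rightarrow> real"
  assumes st: "s \<le> t" "t \<le> s + 1"
    and contw: "continuous_on ({s..t} \<times> {0..1}) (\<lambda>(r, y). w r y)"
    and contg: "continuous_on ({s..t} \<times> {0..1}) (\<lambda>(r, y). g r y)"
    and per: "\<And>r. r \<in> {s..t} \<Longrightarrow> w r 0 = w r 1"
    and char: "\<And>a b x r. s \<le> a \<Longrightarrow> b \<le> t \<Longrightarrow> 0 \<le> x \<Longrightarrow> x + (b - a) \<le> 1 \<Longrightarrow> r \<in> {a..b} \<Longrightarrow>
        ((\<lambda>r. w r (x + (r - a))) has_real_derivative g r (x + (r - a))) (at r within {a..b})"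
  shows "((\<lambda>r. integral {0..1} (\<lambda>x. sgn (w r x) * g r x)) has_integral
          integral {0..1} (\<lambda>x. \<bar>w t x\<bar>) - integral {0..1} (\<lambda>x. \<bar>w s x\<bar>)) {s..t}"
proof -
  \<comment> \<open>Clamping the arguments extends \<open>w\<close> and \<open>g\<close> continuously to the whole plane, where continuity
    gives Borel measurability.\<close>
  define cl where "cl a b x = max a (min b x)" for a b x :: real
  have cl: "cl a b x \<in> {a..b}" if "a \<le> b" for a b x using that by (auto simp: cl_def)
  have cl_id: "cl a b x = x" if "x \<in> {a..b}" for a b x using that by (auto simp: cl_def)
  define W where "W z = w (cl s t (fst z)) (cl 0 1 (snd z))" for z
  define G where "G z = g (cl s t (fst z)) (cl 0 1 (snd z))" for z
  have contcl: "continuous_on UNIV (\<lambda>z. (cl s t (fst z), cl 0 1 (snd z)))"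
    unfolding cl_def by (intro continuous_intros)
  have ranc: "range (\<lambda>z. (cl s t (fst z), cl 0 1 (snd z))) \<subseteq> {s..t} \<times> {0..1}"
    using cl[of s t] cl[of 0 1] st by auto
  have [measurable]: "W \<in> borel_measurable borel"
    using continuous_on_compose2[OF contw contcl ranc]
    by (intro borel_measurable_continuous_onI) (simp add: W_def)
  have [measurable]: "G \<in> borel_measurable borel"
    using continuous_on_compose2[OF contg contcl ranc]
    by (intro borel_measurable_continuous_onI) (simp add: G_def)
  define v where "v r y = sgn (W (r, y)) * G (r, y)" for r y
  have v_meas: "(\<lambda>z. v (f z) (h z)) \<in> borel_measurable N"
    if [measurable]: "f \<in> borel_measurable N" "h \<in> borel_measurable N" for f h N
  proof -
    have [measurable]: "(\<lambda>z. (f z, h z)) \<in> borel_measurable N"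
      unfolding borel_prod[symmetric] by measurable
    show ?thesis unfolding v_def by measurable
  qed
  have v_eq: "v r y = sgn (w r y) * g r y" if "r \<in> {s..t}" "y \<in> {0..1}" for r y
    using that by (simp only: v_def W_def G_def fst_conv snd_conv cl_id)
  obtain M where M: "\<And>r y. r \<in> {s..t} \<Longrightarrow> y \<in> {0..1} \<Longrightarrow> \<bar>g r y\<bar> \<le> M"
  proof -
    have "compact ((\<lambda>(r, y). g r y) ` ({s..t} \<times> {0..1}))"
      by (intro compact_continuous_image contg compact_Times) auto
    then have "bounded ((\<lambda>(r, y). g r y) ` ({s..t} \<times> {0..1}))" by (rule compact_imp_bounded)
    then show ?thesis using that unfolding bounded_iff by fastforce
  qed
  have vM: "\<bar>v r y\<bar> \<le> M" for r y
  proof -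
    have "\<bar>v r y\<bar> \<le> \<bar>G (r, y)\<bar>" unfolding v_def by (auto simp: abs_mult sgn_if)
    also have "\<dots> \<le> M" unfolding G_def using M[of "cl s t r" "cl 0 1 y"] cl[of s t r] cl[of 0 1 y] st by simp
    finally show ?thesis .
  qed
  \<comment> \<open>\<open>\<rho> r x\<close> is the position at time \<open>r\<close> of the point that starts from \<open>x\<close> at time \<open>s\<close>.\<close>
  define \<rho> where "\<rho> r x = (if x + (r - s) \<le> 1 then x + (r - s) else x + (r - s) - 1)" for r x
  define V where "V r x = indicator ({s..t} \<times> {0..1}) (r, x) *\<^sub>R v r (\<rho> r x)" for r x
  have \<rho>_meas: "(\<lambda>z. \<rho> (f z) (h z)) \<in> borel_measurable N"
    if [measurable]: "f \<in> borel_measurable N" "h \<in> borel_measurable N"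
    for f h :: "'b \<Rightarrow> real" and N
    unfolding \<rho>_def by measurable
  have "(fst :: real \<times> real \<Rightarrow> real) \<in> borel_measurable borel" "(snd :: real \<times> real \<Rightarrow> real) \<in> borel_measurable borel"
    by (intro borel_measurable_continuous_onI continuous_intros)+
  then have meas: "(\<lambda>z. v (fst z) (\<rho> (fst z) (snd z))) \<in> borel_measurable borel"
    by (intro v_meas \<rho>_meas)
  have Vint: "integrable (lborel \<Otimes>\<^sub>M lborel) (case_prod V)"
  proof -
    have "integrable lborel (\<lambda>z. indicator ({s..t} \<times> {0..1}) z *\<^sub>R v (fst z) (\<rho> (fst z) (snd z)))"
    proof (rule integrableI_bounded_set_indicator[where B = M])
      have "{s..t} \<times> {0..1::real} = cbox (s, 0) (t, 1)" by (simp add: cbox_Pair_eq)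
      then show "emeasure lborel ({s..t} \<times> {0..1::real}) < \<infinity>"
        using emeasure_lborel_cbox_finite by metis
    qed (use vM meas in \<open>auto simp: closed_Times\<close>)
    then show ?thesis by (simp add: lborel_prod V_def split_beta')
  qed
  have id_meas: "(\<lambda>y::real. y) \<in> borel_measurable borel"
    by (intro borel_measurable_continuous_onI continuous_intros)
  have c_meas: "(\<lambda>_::real. c::real) \<in> borel_measurable borel" for c
    by (rule borel_measurable_const)
  have mvr: "v r \<in> borel_measurable borel" for r
    by (rule v_meas[OF c_meas[of r] id_meas])
  have mr: "(\<lambda>x. v r (\<rho> r x)) \<in> borel_measurable borel" for r
    by (rule v_meas[OF c_meas[of r] \<rho>_meas[OF c_meas[of r] id_meas]])
  have mx: "(\<lambda>r. v r (\<rho> r x)) \<in> borel_measurable borel" for x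
    by (rule v_meas[OF id_meas \<rho>_meas[OF id_meas c_meas[of x]]])
  have int_r: "v r integrable_on {0..1}" for r
    by (rule set_borel_integral_eq_integral(1)[OF set_integrable_lborel_bounded[OF mvr vM]])
  have v_int: "integral {0..1} (v r) = integral {0..1} (\<lambda>x. sgn (w r x) * g r x)" if "r \<in> {s..t}" for r
    by (rule integral_cong) (rule v_eq[OF that])
  have Ix: "(\<integral>x. V r x \<partial>lborel) = indicator {s..t} r *\<^sub>R integral {0..1} (\<lambda>x. sgn (w r x) * g r x)" for r
  proof (cases "r \<in> {s..t}")
    case True
    have "(\<integral>x. V r x \<partial>lborel) = (LINT x:{0..1}|lborel. v r (\<rho> r x))"
      using True by (simp add: V_def set_lebesgue_integral_def indicator_times)
    also have "\<dots> = integral {0..1} (\<lambda>x. v r (\<rho> r x))"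
      by (rule set_borel_integral_eq_integral(2)[OF set_integrable_lborel_bounded[OF mr vM]])
    also have "\<dots> = integral {0..1} (v r)"
      unfolding \<rho>_def by (rule integral_unique[OF has_integral_rotate_unit_interval[OF int_r]]) (use True st in auto)
    finally show ?thesis using True v_int by simp
  qed (simp add: V_def indicator_times)
  have wabs: "(\<lambda>y. \<bar>w r y\<bar>) integrable_on {0..1}" if "r \<in> {s..t}" for r
    by (intro integrable_continuous_real continuous_on_rabs continuous_on_compose_Pair[OF contw]
        continuous_on_const continuous_on_id) (use that in auto)
  define R where "R x = \<bar>w t (\<rho> t x)\<bar> - \<bar>w s x\<bar>" for x
  have arc: "((\<lambda>r. sgn (w r (x + (r - a))) * g r (x + (r - a))) has_integral
      \<bar>w b (x + (b - a))\<bar> - \<bar>w a x\<bar>) {a..b}"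
    if "s \<le> a" "a \<le> b" "b \<le> t" "0 \<le> x" "x + (b - a) \<le> 1" for a b x
  proof -
    have "continuous_on {a..b} (\<lambda>r. g r (x + (r - a)))"
      by (rule continuous_on_compose_Pair[OF contg]) (use that in \<open>auto intro!: continuous_intros\<close>)
    from has_integral_sgn_mult_deriv[OF \<open>a \<le> b\<close> char[of a b x] this] that show ?thesis by simp
  qed
  have arcs: "((\<lambda>r. v r (\<rho> r x)) has_integral R x) {s..t}" if x: "x \<in> {0..1}" for x
  proof (cases "x + (t - s) \<le> 1")
    case True
    have "((\<lambda>r. sgn (w r (x + (r - s))) * g r (x + (r - s))) has_integral R x) {s..t}"
      using arc[of s t x] True x st by (simp add: R_def \<rho>_def)
    then show ?thesis
      by (rule has_integral_eq[rotated]) (use True x in \<open>auto simp: \<rho>_def v_eq\<close>)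
  next
    case False
    \<comment> \<open>\<open>c\<close> is the time at which the path reaches the end point 1 and continues from 0.\<close>
    define c where "c = s + (1 - x)"
    have c: "s \<le> c" "c \<le> t" using False x by (auto simp: c_def)
    have "((\<lambda>r. sgn (w r (x + (r - s))) * g r (x + (r - s))) has_integral \<bar>w c 1\<bar> - \<bar>w s x\<bar>) {s..c}"
      using arc[of s c x] c x by (simp add: c_def)
    then have 1: "((\<lambda>r. v r (\<rho> r x)) has_integral \<bar>w c 1\<bar> - \<bar>w s x\<bar>) {s..c}"
      by (rule has_integral_eq[rotated]) (use c x in \<open>auto simp: \<rho>_def v_eq c_def\<close>)
    have \<rho>_late: "\<rho> r x = r - c" if "c < r" for r using that by (simp add: \<rho>_def c_def)
    have \<rho>_t: "\<rho> t x = t - c" using False by (simp add: \<rho>_def c_def)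
    have "((\<lambda>r. sgn (w r (r - c)) * g r (r - c)) has_integral \<bar>w t (\<rho> t x)\<bar> - \<bar>w c 0\<bar>) {c..t}"
      using arc[of c t 0] c st by (simp add: \<rho>_t)
    moreover have "v r (\<rho> r x) = sgn (w r (r - c)) * g r (r - c)" if r: "r \<in> {c..t} - {c}" for r
    proof -
      have "c < r" using r by auto
      moreover have "r \<in> {s..t}" "r - c \<in> {0..1}" using r c st by auto
      ultimately show ?thesis by (simp only: \<rho>_late v_eq)
    qed
    ultimately have 2: "((\<lambda>r. v r (\<rho> r x)) has_integral \<bar>w t (\<rho> t x)\<bar> - \<bar>w c 0\<bar>) {c..t}"
      using has_integral_spike_finite[of "{c}" "{c..t}" "\<lambda>r. v r (\<rho> r x)"
          "\<lambda>r. sgn (w r (r - c)) * g r (r - c)"] by blast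
    have "w c 0 = w c 1" using per c by auto
    with has_integral_combine[OF c 1 2] show ?thesis by (simp add: R_def)
  qed
  have Ir: "(\<integral>r. V r x \<partial>lborel) = indicator {0..1} x *\<^sub>R R x" for x
  proof (cases "x \<in> {0..1}")
    case True
    have "(\<integral>r. V r x \<partial>lborel) = (LINT r:{s..t}|lborel. v r (\<rho> r x))"
      using True by (simp add: V_def set_lebesgue_integral_def indicator_times)
    also have "\<dots> = integral {s..t} (\<lambda>r. v r (\<rho> r x))"
      by (rule set_borel_integral_eq_integral(2)[OF set_integrable_lborel_bounded[OF mx vM]])
    finally show ?thesis using True arcs[OF True] by (simp add: integral_unique)
  qed (simp add: V_def indicator_times)
  have Rint: "(R has_integral (integral {0..1} (\<lambda>x. \<bar>w t x\<bar>) - integral {0..1} (\<lambda>x. \<bar>w s x\<bar>))) {0..1}"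
    unfolding R_def \<rho>_def
    by (intro has_integral_diff integrable_integral wabs
        has_integral_rotate_unit_interval[where f = "\<lambda>y. \<bar>w t y\<bar>"]) (use st in auto)
  have swap: "(\<integral>x. (\<integral>r. V r x \<partial>lborel) \<partial>lborel) = (\<integral>r. (\<integral>x. V r x \<partial>lborel) \<partial>lborel)"
    by (rule lborel_pair.Fubini_integral[OF Vint])
  have "integrable lborel (\<lambda>r. (\<integral>x. V r x \<partial>lborel))"
    by (rule lborel_pair.integrable_fst[OF Vint])
  then have 1: "set_integrable lborel {s..t} (\<lambda>r. integral {0..1} (\<lambda>x. sgn (w r x) * g r x))"
    unfolding set_integrable_def Ix .
  have "integrable lborel (\<lambda>x. (\<integral>r. V r x \<partial>lborel))"
    by (rule lborel_pair.integrable_snd[OF Vint])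
  then have 2: "set_integrable lborel {0..1} R"
    unfolding set_integrable_def Ir .
  have "integral {s..t} (\<lambda>r. integral {0..1} (\<lambda>x. sgn (w r x) * g r x)) = integral {0..1} R"
    using swap set_borel_integral_eq_integral(2)[OF 1] set_borel_integral_eq_integral(2)[OF 2]
    unfolding Ix Ir set_lebesgue_integral_def by simp
  then have "integral {s..t} (\<lambda>r. integral {0..1} (\<lambda>x. sgn (w r x) * g r x)) =
      integral {0..1} (\<lambda>x. \<bar>w t x\<bar>) - integral {0..1} (\<lambda>x. \<bar>w s x\<bar>)"
    using integral_unique[OF Rint] by simp
  with set_borel_integral_eq_integral(1)[OF 1]
  show "((\<lambda>r. integral {0..1} (\<lambda>x. sgn (w r x) * g r x)) has_integral
          integral {0..1} (\<lambda>x. \<bar>w t x\<bar>) - integral {0..1} (\<lambda>x. \<bar>w s x\<bar>)) {s..t}"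
    unfolding has_integral_iff by blast
qed

lemma le_of_locally_antimono:
  fixes f :: "real \<Rightarrow> real"
  assumes d: "0 < d" and "a \<le> b"
    and step: "\<And>s t. a \<le> s \<Longrightarrow> s \<le> t \<Longrightarrow> t \<le> b \<Longrightarrow> t \<le> s + d \<Longrightarrow> f t \<le> f s"
  shows "f b \<le> f a"
proof -
  have "f (min b (a + real n * d)) \<le> f a" for n
  proof (induction n)
    case 0
    then show ?case using \<open>a \<le> b\<close> by simp
  next
    case (Suc n)
    have "f (min b (a + real (Suc n) * d)) \<le> f (min b (a + real n * d))"
      using d \<open>a \<le> b\<close> by (intro step) (auto simp: algebra_simps)
    with Suc show ?case by simp
  qed
  moreover obtain n :: nat where "(b - a) / d < real n" using reals_Archimedean2 by blast
  then have "min b (a + real n * d) = b" using d by (simp add: field_simps)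
  ultimately show ?thesis by metis
qed

text \<open>
No differential inequality for \<open>\<integral>\<bar>w\<bar>\<close> has to be solved: the function \<open>e\<^sup>-\<^sup>m\<^sup>r w\<close> is again
transported, with source \<open>e\<^sup>-\<^sup>m\<^sup>r (g - m w)\<close>, and the hypotheses say that the corresponding integrals
have a sign for \<open>m = k\<close> and for \<open>m = l\<close>.  The equation along characteristics is demanded only on
time intervals of length at most \<open>d\<close>, which suffices because monotonicity is a local property.
\<close>

lemma transport_L1_exp_bounds:
  fixes w g :: "real \<Rightarrow> real \<Rightarrow> real"
  assumes \<tau>: "0 \<le> \<tau>" and d: "0 < d" "d \<le> 1"
    and contw: "continuous_on ({0..\<tau>} \<times> {0..1}) (\<lambda>(r, y). w r y)"
    and contg: "continuous_on ({0..\<tau>} \<times> {0..1}) (\<lambda>(r, y). g r y)"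
    and per: "\<And>r. r \<in> {0..\<tau>} \<Longrightarrow> w r 0 = w r 1"
    and char: "\<And>a b x r. 0 \<le> a \<Longrightarrow> b \<le> \<tau> \<Longrightarrow> b \<le> a + d \<Longrightarrow> 0 \<le> x \<Longrightarrow> x + (b - a) \<le> 1 \<Longrightarrow>
        r \<in> {a..b} \<Longrightarrow>
        ((\<lambda>r. w r (x + (r - a))) has_real_derivative g r (x + (r - a))) (at r within {a..b})"
    and lower: "\<And>r. r \<in> {0..\<tau>} \<Longrightarrow>
        k * integral {0..1} (\<lambda>x. \<bar>w r x\<bar>) \<le> integral {0..1} (\<lambda>x. sgn (w r x) * g r x)"
    and upper: "\<And>r. r \<in> {0..\<tau>} \<Longrightarrow>
        integral {0..1} (\<lambda>x. sgn (w r x) * g r x) \<le> l * integral {0..1} (\<lambda>x. \<bar>w r x\<bar>)"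
  shows "exp (k * \<tau>) * integral {0..1} (\<lambda>x. \<bar>w 0 x\<bar>) \<le> integral {0..1} (\<lambda>x. \<bar>w \<tau> x\<bar>)"
    and "integral {0..1} (\<lambda>x. \<bar>w \<tau> x\<bar>) \<le> exp (l * \<tau>) * integral {0..1} (\<lambda>x. \<bar>w 0 x\<bar>)"
proof -
  define E where "E m t = exp (- m * t) * integral {0..1} (\<lambda>x. \<bar>w t x\<bar>)" for m t
  define I where "I m r = exp (- m * r) *
    (integral {0..1} (\<lambda>x. sgn (w r x) * g r x) - m * integral {0..1} (\<lambda>x. \<bar>w r x\<bar>))" for m r
  have slice: "continuous_on {0..1} (w r)" "continuous_on {0..1} (g r)" if "r \<in> {0..\<tau>}" for r
    by (rule continuous_on_compose_Pair[OF contw] continuous_on_compose_Pair[OF contg],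
        use that in \<open>auto intro!: continuous_intros\<close>)+
  have incr: "(I m has_integral (E m t - E m s)) {s..t}"
    if st: "0 \<le> s" "s \<le> t" "t \<le> \<tau>" "t \<le> s + d" for m s t
  proof -
    define w' where "w' r x = exp (- m * r) * w r x" for r x
    define g' where "g' r x = exp (- m * r) * (g r x - m * w r x)" for r x
    have sub: "{s..t} \<times> {0..1} \<subseteq> {0..\<tau>} \<times> {0..1::real}" using st by auto
    have "((\<lambda>r. integral {0..1} (\<lambda>x. sgn (w' r x) * g' r x)) has_integral
          integral {0..1} (\<lambda>x. \<bar>w' t x\<bar>) - integral {0..1} (\<lambda>x. \<bar>w' s x\<bar>)) {s..t}"
    proof (rule transport_L1_identity)
      have c1: "continuous_on ({s..t} \<times> {0..1}) (\<lambda>z. w (fst z) (snd z))"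
        and c2: "continuous_on ({s..t} \<times> {0..1}) (\<lambda>z. g (fst z) (snd z))"
        using contw contg sub by (auto simp: split_beta intro: continuous_on_subset)
      show "continuous_on ({s..t} \<times> {0..1}) (\<lambda>(r, y). w' r y)"
        "continuous_on ({s..t} \<times> {0..1}) (\<lambda>(r, y). g' r y)"
        unfolding w'_def g'_def split_beta by (intro continuous_intros c1 c2)+
      show "w' r 0 = w' r 1" if "r \<in> {s..t}" for r
        using per[of r] that st by (simp add: w'_def)
      fix a b x r :: real
      assume *: "s \<le> a" "b \<le> t" "0 \<le> x" "x + (b - a) \<le> 1" "r \<in> {a..b}"
      have D: "((\<lambda>r. w r (x + (r - a))) has_real_derivative g r (x + (r - a))) (at r within {a..b})"
        using * st by (intro char) auto
      show "((\<lambda>r. w' r (x + (r - a))) has_real_derivative g' r (x + (r - a))) (at r within {a..b})"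
        unfolding w'_def g'_def
        by (rule derivative_eq_intros D refl | simp add: algebra_simps)+
    qed (use st d in auto)
    moreover have rate: "integral {0..1} (\<lambda>x. sgn (w' r x) * g' r x) = I m r" if "r \<in> {s..t}" for r
    proof -
      have r: "r \<in> {0..\<tau>}" using that st by auto
      have "integral {0..1} (\<lambda>x. sgn (w' r x) * g' r x) =
        integral {0..1} (\<lambda>x. exp (- m * r) * (sgn (w r x) * g r x - m * \<bar>w r x\<bar>))"
        by (intro integral_cong) (simp add: w'_def g'_def sgn_mult abs_sgn algebra_simps)
      also have "\<dots> = exp (- m * r) * integral {0..1} (\<lambda>x. sgn (w r x) * g r x - m * \<bar>w r x\<bar>)"
        by (rule integral_mult_right)
      also have "integral {0..1} (\<lambda>x. sgn (w r x) * g r x - m * \<bar>w r x\<bar>) =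
          integral {0..1} (\<lambda>x. sgn (w r x) * g r x) - integral {0..1} (\<lambda>x. m * \<bar>w r x\<bar>)"
        by (intro integral_diff sgn_mult_integral_approx(1) integrable_continuous_real
            continuous_on_mult continuous_on_const continuous_on_rabs slice r)
      also have "integral {0..1} (\<lambda>x. m * \<bar>w r x\<bar>) = m * integral {0..1} (\<lambda>x. \<bar>w r x\<bar>)"
        by (rule integral_mult_right)
      also have "exp (- m * r) * (integral {0..1} (\<lambda>x. sgn (w r x) * g r x) -
          m * integral {0..1} (\<lambda>x. \<bar>w r x\<bar>)) = I m r" by (simp only: I_def)
      finally show ?thesis .
    qed
    moreover have "integral {0..1} (\<lambda>x. \<bar>w' r x\<bar>) = E m r" for r
      by (simp add: w'_def E_def abs_mult)
    ultimately have "((\<lambda>r. integral {0..1} (\<lambda>x. sgn (w' r x) * g' r x)) has_integral (E m t - E m s)) {s..t}"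
      by simp
    then show ?thesis 
      by (rule has_integral_eq[rotated]) (rule rate)
  qed
  have "- E k \<tau> \<le> - E k 0"
  proof (rule le_of_locally_antimono[OF d(1) \<tau>])
    fix s t assume st: "0 \<le> s" "s \<le> t" "t \<le> \<tau>" "t \<le> s + d"
    have "0 \<le> E k t - E k s"
      by (rule has_integral_nonneg[OF incr[OF st]]) (use lower st in \<open>auto simp: I_def\<close>)
    then show "- E k t \<le> - E k s" by simp
  qed
  then show "exp (k * \<tau>) * integral {0..1} (\<lambda>x. \<bar>w 0 x\<bar>) \<le> integral {0..1} (\<lambda>x. \<bar>w \<tau> x\<bar>)"
    by (simp add: E_def exp_minus field_simps)
  have "E l \<tau> \<le> E l 0"
  proof (rule le_of_locally_antimono[OF d(1) \<tau>])
    fix s t assume st: "0 \<le> s" "s \<le> t" "t \<le> \<tau>" "t \<le> s + d"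
    have "0 \<le> - (E l t - E l s)"
      by (rule has_integral_nonneg[OF has_integral_neg[OF incr[OF st]]])
        (use upper st in \<open>auto simp: I_def mult_le_0_iff\<close>)
    then show "E l t \<le> E l s" by simp
  qed
  then show "integral {0..1} (\<lambda>x. \<bar>w \<tau> x\<bar>) \<le> exp (l * \<tau>) * integral {0..1} (\<lambda>x. \<bar>w 0 x\<bar>)"
    by (simp add: E_def exp_minus field_simps)
qed

section \<open>The growth rates \<open>k_min\<close> and \<open>k_max\<close>\<close>

lemma standing_assumptionsD:
  assumes "standing_assumptions K \<Phi>"
  shows "0 < \<Phi>"
    and "(K has_real_derivative deriv K y) (at y)"
    and "(deriv K has_real_derivative deriv (deriv K) y) (at y)"
    and "continuous_on S K" and "continuous_on S (deriv K)" and "continuous_on S (deriv (deriv K))"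
proof -
  note * = assms[unfolded standing_assumptions_def C2_real_def]
  show "0 < \<Phi>" using * by blast
  show K: "(K has_real_derivative deriv K y) (at y)" for y
    using * DERIV_deriv_iff_real_differentiable by blast
  show K': "(deriv K has_real_derivative deriv (deriv K) y) (at y)" for y
    using * DERIV_deriv_iff_real_differentiable by blast
  show "continuous_on S K"
    by (rule DERIV_continuous_on[OF has_field_derivative_at_within[OF K]])
  show "continuous_on S (deriv K)"
    by (rule DERIV_continuous_on[OF has_field_derivative_at_within[OF K']])
  show "continuous_on S (deriv (deriv K))" using * continuous_on_subset by blast
qed

lemma continuous_on_compose_K:
  assumes "standing_assumptions K \<Phi>" and f: "continuous_on S f"
  shows "continuous_on S (\<lambda>x. K (f x))" and "continuous_on S (\<lambda>x. deriv K (f x))"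
  using continuous_on_compose2[OF standing_assumptionsD(4)[OF assms(1)] f subset_UNIV]
    continuous_on_compose2[OF standing_assumptionsD(5)[OF assms(1)] f subset_UNIV] .

lemma k_min_k_max_eq_integral:
  assumes "standing_assumptions K \<Phi>"
  shows "k_min K \<Phi> = deriv K 0 + integral {0..\<Phi>} (\<lambda>y. neg_part (deriv (deriv K) y))"
    and "k_max K \<Phi> = deriv K 0 + integral {0..\<Phi>} (\<lambda>y. pos_part (deriv (deriv K) y))"
  unfolding k_min_def k_max_def neg_part_def pos_part_def
  by (simp_all add: set_borel_integral_eq_integral(2) borel_integrable_atLeastAtMost'
      continuous_intros standing_assumptionsD(6)[OF assms])

text \<open>
The weight \<open>K'\<close> is not monotone, so it is written as \<open>K'(0) + B\<^sub>+ - B\<^sub>-\<close> with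
\<open>B\<^sub>+ = 1 + \<integral>\<^sub>0 (K'')\<^sub>+\<close> and \<open>B\<^sub>- = 1 - \<integral>\<^sub>0 (K'')\<^sub>-\<close>.  Both are increasing with value 1 at 0, so the
summand 1, which makes them positive, cancels in the final bounds.
\<close>

lemma integral_sgn_growth_bounds:
  fixes u\<^sub>1 u\<^sub>2 v\<^sub>1 v\<^sub>2 :: "real \<Rightarrow> real"
  assumes K: "standing_assumptions K \<Phi>" and ab: "a \<le> b"
    and der1: "\<And>x. x \<in> {a..b} \<Longrightarrow> (u\<^sub>1 has_real_derivative v\<^sub>1 x) (at x within {a..b})"
    and der2: "\<And>x. x \<in> {a..b} \<Longrightarrow> (u\<^sub>2 has_real_derivative v\<^sub>2 x) (at x within {a..b})"
    and cont1: "continuous_on {a..b} v\<^sub>1" and cont2: "continuous_on {a..b} v\<^sub>2"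
    and nn1: "\<And>x. x \<in> {a..b} \<Longrightarrow> 0 \<le> v\<^sub>1 x" and nn2: "\<And>x. x \<in> {a..b} \<Longrightarrow> 0 \<le> v\<^sub>2 x"
    and ran1: "\<And>x. x \<in> {a..b} \<Longrightarrow> u\<^sub>1 x \<in> {0..\<Phi>}" and ran2: "\<And>x. x \<in> {a..b} \<Longrightarrow> u\<^sub>2 x \<in> {0..\<Phi>}"
    and eqa: "u\<^sub>1 a = u\<^sub>2 a" and eqb: "u\<^sub>1 b = u\<^sub>2 b"
  defines "g \<equiv> \<lambda>x. deriv K (u\<^sub>1 x) * v\<^sub>1 x - deriv K (u\<^sub>2 x) * v\<^sub>2 x"
  shows "k_min K \<Phi> * integral {a..b} (\<lambda>x. \<bar>v\<^sub>1 x - v\<^sub>2 x\<bar>)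
           \<le> integral {a..b} (\<lambda>x. sgn (v\<^sub>1 x - v\<^sub>2 x) * g x)" (is ?lower)
    and "integral {a..b} (\<lambda>x. sgn (v\<^sub>1 x - v\<^sub>2 x) * g x)
           \<le> k_max K \<Phi> * integral {a..b} (\<lambda>x. \<bar>v\<^sub>1 x - v\<^sub>2 x\<bar>)" (is ?upper)
proof -
  have \<Phi>: "0 \<le> \<Phi>" using standing_assumptionsD(1)[OF K] by simp
  define P where "P = (\<lambda>y. pos_part (deriv (deriv K) y))"
  define M where "M = (\<lambda>y. - neg_part (deriv (deriv K) y))"
  have contPM: "continuous_on S P" "continuous_on S M" for S
    unfolding P_def M_def pos_part_def neg_part_def
    by (intro continuous_intros standing_assumptionsD(6)[OF K])+
  have nnPM: "0 \<le> P y" "0 \<le> M y" and PM: "deriv (deriv K) y = P y - M y" for y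
    by (auto simp: P_def M_def pos_part_def neg_part_def)
  define B where "B h y = 1 + integral {0..y} h" for h :: "real \<Rightarrow> real" and y
  define I where "I h = integral {a..b} (\<lambda>x. sgn (v\<^sub>1 x - v\<^sub>2 x) * (B h (u\<^sub>1 x) * v\<^sub>1 x - B h (u\<^sub>2 x) * v\<^sub>2 x))" for h
  define L where "L = integral {a..b} (\<lambda>x. \<bar>v\<^sub>1 x - v\<^sub>2 x\<bar>)"
  have contB: "continuous_on {0..\<Phi>} (B h)" if "continuous_on {0..\<Phi>} h" for h
    unfolding B_def
    by (intro continuous_intros indefinite_integral_continuous_1 integrable_continuous_real that)
  have cu: "continuous_on {a..b} u\<^sub>1" "continuous_on {a..b} u\<^sub>2"
    by (rule DERIV_continuous_on[OF der1], assumption) (rule DERIV_continuous_on[OF der2], assumption)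
  have contBu: "continuous_on {a..b} (\<lambda>x. B h (u\<^sub>1 x))" "continuous_on {a..b} (\<lambda>x. B h (u\<^sub>2 x))"
    if "continuous_on {0..\<Phi>} h" for h
    by (rule continuous_on_compose2[OF contB[OF that]], rule cu, use ran1 ran2 in blast)+
  have bounds: "L \<le> I h" "I h \<le> B h \<Phi> * L"
    if h: "continuous_on {0..\<Phi>} h" "\<And>y. 0 \<le> h y" for h
  proof -
    have derA: "((\<lambda>z. integral {0..z} (B h)) has_real_derivative B h y) (at y within {0..\<Phi>})"
      if "y \<in> {0..\<Phi>}" for y
      using integral_has_real_derivative[OF contB[OF h(1)] that] .
    have mono: "mono_on {0..\<Phi>} (B h)"
    proof (rule mono_onI)
      fix y z assume *: "y \<in> {0..\<Phi>}" "z \<in> {0..\<Phi>}" "y \<le> z"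
      have "integral {0..y} h \<le> integral {0..z} h"
        using * h by (intro integral_subset_le integrable_continuous_real)
          (auto intro: continuous_on_subset)
      then show "B h y \<le> B h z" by (simp add: B_def)
    qed
    have B0: "B h 0 = 1" "0 < B h 0" by (simp_all add: B_def)
    have "B h 0 * L \<le> I h" unfolding L_def I_def
      by (rule integral_sgn_weighted_bounds(1)[OF ab \<Phi> der1 der2 cont1 cont2 nn1 nn2 ran1 ran2 eqa eqb
            derA contB[OF h(1)] mono B0(2)])
    then show "L \<le> I h" using B0 by simp
    show "I h \<le> B h \<Phi> * L" unfolding L_def I_def
      by (rule integral_sgn_weighted_bounds(2)[OF ab \<Phi> der1 der2 cont1 cont2 nn1 nn2 ran1 ran2 eqa eqb
            derA contB[OF h(1)] mono B0(2)])
  qed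
  have K': "deriv K y = deriv K 0 + B P y - B M y" if "y \<in> {0..\<Phi>}" for y
  proof -
    have "((\<lambda>z. deriv (deriv K) z) has_integral (deriv K y - deriv K 0)) {0..y}"
      using that standing_assumptionsD(3)[OF K]
      by (intro fundamental_theorem_of_calculus)
        (auto simp: has_real_derivative_iff_has_vector_derivative[symmetric]
          intro: has_field_derivative_at_within)
    then have "deriv K y - deriv K 0 = integral {0..y} (\<lambda>z. P z - M z)"
      unfolding PM by (simp add: integral_unique)
    also have "\<dots> = integral {0..y} P - integral {0..y} M"
      by (intro integral_diff integrable_continuous_real contPM)
    finally show ?thesis by (simp add: B_def)
  qed
  have split: "integral {a..b} (\<lambda>x. sgn (v\<^sub>1 x - v\<^sub>2 x) * g x) = deriv K 0 * L + I P - I M"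
  proof -
    define s where "s x = sgn (v\<^sub>1 x - v\<^sub>2 x)" for x
    define F where "F h x = B h (u\<^sub>1 x) * v\<^sub>1 x - B h (u\<^sub>2 x) * v\<^sub>2 x" for h x
    have int: "((\<lambda>x. s x * F h x) has_integral I h) {a..b}" if "continuous_on {0..\<Phi>} h" for h
      unfolding I_def s_def F_def
      by (intro integrable_integral sgn_mult_integral_approx(1) continuous_on_diff continuous_on_mult
          contBu[OF that] cont1 cont2)
    have intL: "((\<lambda>x. \<bar>v\<^sub>1 x - v\<^sub>2 x\<bar>) has_integral L) {a..b}"
      unfolding L_def
      by (intro integrable_integral integrable_continuous_real continuous_on_rabs continuous_on_diff cont1 cont2)
    have "((\<lambda>x. deriv K 0 * \<bar>v\<^sub>1 x - v\<^sub>2 x\<bar> + s x * F P x - s x * F M x) has_integral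
        (deriv K 0 * L + I P - I M)) {a..b}"
      by (rule has_integral_diff[OF has_integral_add[OF has_integral_mult_right[OF intL] int[OF contPM(1)]]
            int[OF contPM(2)]])
    moreover have "deriv K 0 * \<bar>v\<^sub>1 x - v\<^sub>2 x\<bar> + s x * F P x - s x * F M x = s x * g x"
      if x: "x \<in> {a..b}" for x
      unfolding abs_sgn[of "v\<^sub>1 x - v\<^sub>2 x"] s_def F_def g_def K'[OF ran1[OF x]] K'[OF ran2[OF x]]
      by (simp add: algebra_simps)
    ultimately have "((\<lambda>x. s x * g x) has_integral (deriv K 0 * L + I P - I M)) {a..b}"
      by (rule has_integral_eq[rotated])
    then show ?thesis unfolding s_def by (rule integral_unique)
  qed
  have "k_max K \<Phi> = deriv K 0 + B P \<Phi> - 1" "k_min K \<Phi> = deriv K 0 + 1 - B M \<Phi>"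
    by (simp_all add: k_min_k_max_eq_integral[OF K] B_def P_def M_def)
  then have "k_max K \<Phi> * L = deriv K 0 * L + B P \<Phi> * L - L" "k_min K \<Phi> * L = deriv K 0 * L + L - B M \<Phi> * L"
    by (simp_all only: left_diff_distrib distrib_right mult_1_left)
  then show ?lower ?upper
    using bounds[OF contPM(1) nnPM(1)] bounds[OF contPM(2) nnPM(2)]
    unfolding split L_def[symmetric] by linarith+
qed

section \<open>Classical solutions along characteristics\<close>

lemma time_domD:
  assumes "ereal \<tau> < T" "0 \<le> \<tau>"
  shows "{0..\<tau>} \<subseteq> time_dom T"
  using assms by (auto simp: time_dom_def) (metis ereal_less_eq(3) le_less_trans)

lemma at_within_time_dom_neq_bot:
  assumes "t \<in> time_dom T"
  shows "at t within time_dom T \<noteq> bot"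
proof -
  obtain u where u: "t < u" "ereal u < T"
    using assms ereal_dense2[of t T] by (auto simp: time_dom_def)
  have "0 \<le> t" using assms by (simp add: time_dom_def)
  then have "{t..u} \<subseteq> {0..u}" "0 \<le> u" using u(1) by auto
  then have "{t..u} \<subseteq> time_dom T" using time_domD[OF u(2)] by blast
  moreover have "t islimpt {t..u}" using u by (simp add: islimpt_Icc)
  ultimately show ?thesis
    using islimpt_subset trivial_limit_within by blast
qed

lemma C1_on_has_derivative_along_curve:
  fixes f :: "real \<Rightarrow> real \<Rightarrow> real" and D :: "real \<times> real \<Rightarrow> (real \<times> real) \<Rightarrow>\<^sub>L real"
  assumes f: "\<And>z. z \<in> S \<Longrightarrow> ((\<lambda>(x, y). f x y) has_derivative blinfun_apply (D z)) (at z within S)"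
    and ran: "\<And>r. r \<in> I \<Longrightarrow> (\<alpha> r, \<beta> r) \<in> S" and r: "r \<in> I"
    and \<alpha>: "(\<alpha> has_real_derivative p) (at r within I)"
    and \<beta>: "(\<beta> has_real_derivative q) (at r within I)"
  shows "((\<lambda>r. f (\<alpha> r) (\<beta> r)) has_real_derivative blinfun_apply (D (\<alpha> r, \<beta> r)) (p, q)) (at r within I)"
proof -
  have "((\<lambda>r. (\<alpha> r, \<beta> r)) has_derivative (\<lambda>h. (p * h, q * h))) (at r within I)"
    using \<alpha> \<beta> unfolding has_field_derivative_def by (rule has_derivative_Pair)
  moreover have "(\<lambda>r. (\<alpha> r, \<beta> r)) ` I \<subseteq> S" using ran by auto
  ultimately have "((\<lambda>r. case (\<alpha> r, \<beta> r) of (x, y) \<Rightarrow> f x y) has_derivative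
      (\<lambda>h. blinfun_apply (D (\<alpha> r, \<beta> r)) (p * h, q * h))) (at r within I)"
    using has_derivative_in_compose2[of S "\<lambda>(x, y). f x y" "\<lambda>z. blinfun_apply (D z)" "\<lambda>r. (\<alpha> r, \<beta> r)" I r] f r
    by blast
  moreover have "blinfun_apply (D (\<alpha> r, \<beta> r)) (p * h, q * h) = blinfun_apply (D (\<alpha> r, \<beta> r)) (p, q) * h" for h
  proof -
    have "(p * h, q * h) = h *\<^sub>R (p, q)" by simp
    then show ?thesis by (simp only: blinfun.scaleR_right real_scaleR_def mult.commute)
  qed
  ultimately show ?thesis by (simp add: has_field_derivative_def)
qed

text \<open>
The estimate compares two solutions, which may exist for different times; facts proved here for one
of them up to the time \<open>\<tau>\<close> apply to both.
\<close>

locale solution =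
  fixes K :: "real \<Rightarrow> real" and \<Phi> :: real and T :: ereal and Qinit :: "real \<Rightarrow> real"
    and Q :: "real \<Rightarrow> real \<Rightarrow> real" and N :: "real \<Rightarrow> real" and \<tau> :: real
  assumes K: "standing_assumptions K \<Phi>"
    and sol: "classical_solution K \<Phi> T Qinit Q N"
    and \<tau>: "0 \<le> \<tau>" "ereal \<tau> < T"
begin

abbreviation q :: "real \<Rightarrow> real \<Rightarrow> real" where "q \<equiv> d_eta Q"

lemma time: "t \<in> {0..\<tau>} \<Longrightarrow> t \<in> time_dom T"
  using time_domD[OF \<tau>(2,1)] by blast

lemma Q_init: "Q 0 1 = \<Phi>" and Q_at_0: "t \<in> time_dom T \<Longrightarrow> Q t 0 = 0"
  and Q_mono: "t \<in> time_dom T \<Longrightarrow> mono_on {0..1} (Q t)"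
  and flux: "t \<in> time_dom T \<Longrightarrow> 1 / N t = q t 1 - K \<Phi>"
  and pde: "t \<in> time_dom T \<Longrightarrow> y \<in> {0<..<1} \<Longrightarrow> d_tau T Q t y + q t y = 1 / N t + K (Q t y)"
  using sol
  unfolding classical_solution_def satisfies_system_def admissible_datum_def by auto

text \<open>
In terms of the total derivative \<open>D\<close>, the equation prescribes the derivative in the characteristic
direction \<open>(1, 1)\<close>.  It is imposed for \<open>0 < y < 1\<close> and extends to \<open>y = 0\<close> and \<open>y = 1\<close> by continuity;
the boundary identities below rely on this.
\<close>

lemma total_derivative:
  obtains D :: "real \<times> real \<Rightarrow> (real \<times> real) \<Rightarrow>\<^sub>L real"
  where "continuous_on (time_dom T \<times> {0..1}) D"
    and "\<And>z. z \<in> time_dom T \<times> {0..1} \<Longrightarrow>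
      ((\<lambda>(t, y). Q t y) has_derivative blinfun_apply (D z)) (at z within time_dom T \<times> {0..1})"
    and "\<And>t y. t \<in> time_dom T \<Longrightarrow> y \<in> {0..1} \<Longrightarrow> q t y = blinfun_apply (D (t, y)) (0, 1)"
    and "\<And>t y. t \<in> time_dom T \<Longrightarrow> y \<in> {0..1} \<Longrightarrow> blinfun_apply (D (t, y)) (1, 1) = 1 / N t + K (Q t y)"
proof -
  obtain D where D: "continuous_on (time_dom T \<times> {0..1}) D"
    "\<And>z. z \<in> time_dom T \<times> {0..1} \<Longrightarrow>
      ((\<lambda>(t, y). Q t y) has_derivative blinfun_apply (D z)) (at z within time_dom T \<times> {0..1})"
    using sol unfolding classical_solution_def C1_on_def by auto
  have q: "q t y = blinfun_apply (D (t, y)) (0, 1)" if "t \<in> time_dom T" "y \<in> {0..1}" for t y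
  proof -
    have "((\<lambda>y. Q t y) has_real_derivative blinfun_apply (D (t, y)) (0, 1)) (at y within {0..1})"
      by (rule C1_on_has_derivative_along_curve[where D = D, OF D(2)]) (use that in auto)
    then show ?thesis unfolding d_eta_def
      using that by (intro vector_derivative_within_closed_interval)
        (auto simp: has_real_derivative_iff_has_vector_derivative)
  qed
  have d_tau: "d_tau T Q t y = blinfun_apply (D (t, y)) (1, 0)" if "t \<in> time_dom T" "y \<in> {0..1}" for t y
  proof -
    have "((\<lambda>t. Q t y) has_real_derivative blinfun_apply (D (t, y)) (1, 0)) (at t within time_dom T)"
      by (rule C1_on_has_derivative_along_curve[where D = D, OF D(2)]) (use that in auto)
    then show ?thesis unfolding d_tau_def
      using at_within_time_dom_neq_bot[OF that(1)]
      by (intro vector_derivative_within) (auto simp: has_real_derivative_iff_has_vector_derivative)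
  qed
  have "blinfun_apply (D (t, y)) (1, 1) = 1 / N t + K (Q t y)" if t: "t \<in> time_dom T" and y: "y \<in> {0..1}" for t y
  proof -
    define F where "F y = blinfun_apply (D (t, y)) (1, 1) - (1 / N t + K (Q t y))" for y
    have "continuous_on {0..1} (\<lambda>y. D (t, y))"
      by (rule continuous_on_compose2[OF D(1)]) (use t in \<open>auto intro!: continuous_intros\<close>)
    moreover have "continuous_on {0..1} (Q t)"
    proof (rule DERIV_continuous_on)
      show "((\<lambda>y. Q t y) has_real_derivative blinfun_apply (D (t, y)) (0, 1)) (at y within {0..1})"
        if "y \<in> {0..1}" for y
        by (rule C1_on_has_derivative_along_curve[where D = D, OF D(2)]) (use t that in auto)
    qed
    ultimately have "continuous_on {0..1} F" unfolding F_def
      by (intro continuous_on_diff continuous_on_add continuous_on_const continuous_on_compose_K(1)[OF K]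
          blinfun.continuous_on)
    moreover have "F y = 0" if "y \<in> {0<..<1}" for y
    proof -
      have "blinfun_apply (D (t, y)) (1, 1) = blinfun_apply (D (t, y)) (1, 0) + blinfun_apply (D (t, y)) (0, 1)"
        unfolding blinfun.add_right[symmetric] by simp
      then show ?thesis using pde[OF t that] q[OF t, of y] d_tau[OF t, of y] that by (simp add: F_def)
    qed
    ultimately have "F y = 0"
      using continuous_constant_on_closure[of "{0<..<1}" F 0 y] y by simp
    then show ?thesis by (simp add: F_def)
  qed
  with D q show ?thesis by (rule that)
qed

text \<open>
The direction \<open>(p, p')\<close> is \<open>p\<close> times the characteristic direction plus \<open>p' - p\<close> times the \<open>\<eta>\<close>
direction.  Horizontal, vertical and characteristic curves are the cases of interest.
\<close>

lemma Q_along_curve: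
  assumes "\<And>r. r \<in> I \<Longrightarrow> \<alpha> r \<in> time_dom T \<and> \<beta> r \<in> {0..1}" "r \<in> I"
    and "(\<alpha> has_real_derivative p) (at r within I)" "(\<beta> has_real_derivative p') (at r within I)"
  shows "((\<lambda>r. Q (\<alpha> r) (\<beta> r)) has_real_derivative
      (p * (1 / N (\<alpha> r) + K (Q (\<alpha> r) (\<beta> r))) + (p' - p) * q (\<alpha> r) (\<beta> r))) (at r within I)"
proof -
  obtain D :: "real \<times> real \<Rightarrow> (real \<times> real) \<Rightarrow>\<^sub>L real" where D:
    "\<And>z. z \<in> time_dom T \<times> {0..1} \<Longrightarrow>
      ((\<lambda>(t, y). Q t y) has_derivative blinfun_apply (D z)) (at z within time_dom T \<times> {0..1})"
    "\<And>t y. t \<in> time_dom T \<Longrightarrow> y \<in> {0..1} \<Longrightarrow> q t y = blinfun_apply (D (t, y)) (0, 1)"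
    "\<And>t y. t \<in> time_dom T \<Longrightarrow> y \<in> {0..1} \<Longrightarrow> blinfun_apply (D (t, y)) (1, 1) = 1 / N t + K (Q t y)"
    using total_derivative by metis
  have "(p, p') = p *\<^sub>R (1, 1) + (p' - p) *\<^sub>R (0, 1)" by simp
  then have "blinfun_apply (D (\<alpha> r, \<beta> r)) (p, p') =
      p * (1 / N (\<alpha> r) + K (Q (\<alpha> r) (\<beta> r))) + (p' - p) * q (\<alpha> r) (\<beta> r)"
    using D(2,3)[of "\<alpha> r" "\<beta> r"] assms(1,2)
    by (simp only: blinfun.add_right blinfun.scaleR_right real_scaleR_def)
  moreover have "((\<lambda>r. Q (\<alpha> r) (\<beta> r)) has_real_derivative blinfun_apply (D (\<alpha> r, \<beta> r)) (p, p')) (at r within I)"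
    by (rule C1_on_has_derivative_along_curve[where D = D, OF D(1)]) (use assms in auto)
  ultimately show ?thesis by simp
qed

lemma Q_eta_derivative:
  assumes "t \<in> time_dom T" "y \<in> {0..1}"
  shows "(Q t has_real_derivative q t y) (at y within {0..1})"
  using Q_along_curve[of "{0..1}" "\<lambda>_. t" "\<lambda>y. y" y 0 1] assms by auto

lemma Q_tau_derivative:
  assumes "t \<in> time_dom T" "y \<in> {0..1}"
  shows "((\<lambda>t. Q t y) has_real_derivative 1 / N t + K (Q t y) - q t y) (at t within time_dom T)"
  using Q_along_curve[of "time_dom T" "\<lambda>t. t" "\<lambda>_. y" t 1 0] assms by auto

lemma continuous_on_Q: "continuous_on (time_dom T \<times> {0..1}) (\<lambda>(t, y). Q t y)"
  and continuous_on_q: "continuous_on (time_dom T \<times> {0..1}) (\<lambda>(t, y). q t y)"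
proof -
  obtain D :: "real \<times> real \<Rightarrow> (real \<times> real) \<Rightarrow>\<^sub>L real" where D:
    "continuous_on (time_dom T \<times> {0..1}) D"
    "\<And>z. z \<in> time_dom T \<times> {0..1} \<Longrightarrow>
      ((\<lambda>(t, y). Q t y) has_derivative blinfun_apply (D z)) (at z within time_dom T \<times> {0..1})"
    "\<And>t y. t \<in> time_dom T \<Longrightarrow> y \<in> {0..1} \<Longrightarrow> q t y = blinfun_apply (D (t, y)) (0, 1)"
    using total_derivative by metis
  show "continuous_on (time_dom T \<times> {0..1}) (\<lambda>(t, y). Q t y)"
    by (rule has_derivative_continuous_on[OF D(2)])
  have "continuous_on (time_dom T \<times> {0..1}) (\<lambda>z. blinfun_apply (D z) (0, 1))"
    by (intro continuous_intros D(1))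
  then show "continuous_on (time_dom T \<times> {0..1}) (\<lambda>(t, y). q t y)"
    by (rule continuous_on_eq) (auto simp: D(3))
qed

text \<open>
At \<open>\<eta> = 1\<close> the condition on the flux turns the equation into the scalar problem
\<open>y' = K(y) - K(\<Phi>)\<close>, \<open>y(0) = \<Phi>\<close>, whose only solution is constant because \<open>K\<close> is Lipschitz; the
uniqueness argument is that \<open>(y - \<Phi>)\<^sup>2 e\<^sup>-\<^sup>2\<^sup>L\<^sup>t\<close> decreases.
\<close>

lemma Q_at_1:
  assumes t: "t \<in> {0..\<tau>}"
  shows "Q t 1 = \<Phi>"
proof -
  obtain L where L: "\<And>y. \<bar>deriv K y\<bar> \<le> L"
    using K unfolding standing_assumptions_def bounded_iff by auto
  define f where "f t = Q t 1 - \<Phi>" for t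
  define E where "E t = (f t)\<^sup>2 * exp (- 2 * L * t)" for t
  have lip: "\<bar>K y - K z\<bar> \<le> L * \<bar>y - z\<bar>" for y z
    using field_differentiable_bound[of UNIV K "deriv K" L y z] standing_assumptionsD(2)[OF K] L
    by auto
  have f: "(f has_real_derivative K (Q r 1) - K \<Phi>) (at r within {0..t})" if "r \<in> {0..t}" for r
  proof -
    have r: "r \<in> time_dom T" and sub: "{0..t} \<subseteq> time_dom T" using that t time by auto
    have "((\<lambda>r. Q r 1 - \<Phi>) has_real_derivative K (Q r 1) - K \<Phi>) (at r within {0..t})"
      by (rule derivative_eq_intros DERIV_subset[OF Q_tau_derivative[OF r] sub] refl
          | simp add: flux[OF r])+
    then show ?thesis unfolding f_def .
  qed
  have E: "(E has_real_derivative
      2 * (f r * (K (Q r 1) - K \<Phi>) - L * (f r)\<^sup>2) * exp (- 2 * L * r)) (at r within {0..t})"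
    if "r \<in> {0..t}" for r
    unfolding E_def by (rule derivative_eq_intros f[OF that] refl | simp add: algebra_simps power2_eq_square)+
  have "E t \<le> E 0"
  proof (rule DERIV_nonpos_imp_decreasing_open[of 0 t])
    show "0 \<le> t" using t by simp
    show "continuous_on {0..t} E" by (rule DERIV_continuous_on[OF E])
    fix r assume r: "0 < r" "r < t"
    have "f r * (K (Q r 1) - K \<Phi>) \<le> \<bar>f r\<bar> * \<bar>K (Q r 1) - K \<Phi>\<bar>"
      by (metis abs_ge_self abs_mult)
    also have "\<dots> \<le> \<bar>f r\<bar> * (L * \<bar>f r\<bar>)"
      using lip[of "Q r 1" \<Phi>] by (intro mult_left_mono) (auto simp: f_def)
    also have "\<dots> = L * (f r)\<^sup>2" by (simp add: power2_eq_square)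
    finally have "f r * (K (Q r 1) - K \<Phi>) - L * (f r)\<^sup>2 \<le> 0" by (simp only: diff_le_0_iff_le)
    then have "2 * (f r * (K (Q r 1) - K \<Phi>) - L * (f r)\<^sup>2) \<le> 0"
      by (rule mult_nonneg_nonpos[OF zero_le_numeral])
    then have "2 * (f r * (K (Q r 1) - K \<Phi>) - L * (f r)\<^sup>2) * exp (- 2 * L * r) \<le> 0"
      by (rule mult_nonpos_nonneg) simp
    moreover have "(E has_real_derivative
      2 * (f r * (K (Q r 1) - K \<Phi>) - L * (f r)\<^sup>2) * exp (- 2 * L * r)) (at r)"
      using E[of r] r at_within_Icc_at[of 0 r t] by auto
    ultimately show "\<exists>y. (E has_real_derivative y) (at r) \<and> y \<le> 0" by blast
  qed
  then have "E t \<le> 0" by (simp add: E_def f_def Q_init)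
  then have "f t = 0" by (simp add: E_def mult_le_0_iff not_le)
  then show ?thesis by (simp add: f_def)
qed

lemma Q_range:
  assumes "t \<in> {0..\<tau>}" "y \<in> {0..1}"
  shows "Q t y \<in> {0..\<Phi>}"
proof -
  note mono = mono_onD[OF Q_mono[OF time[OF assms(1)]]]
  have "Q t 0 \<le> Q t y" "Q t y \<le> Q t 1"
    using assms(2) by (auto intro!: mono)
  then show ?thesis using Q_at_0[OF time[OF assms(1)]] Q_at_1[OF assms(1)] by simp
qed

lemma q_nonneg:
  assumes "t \<in> time_dom T" "y \<in> {0..1}"
  shows "0 \<le> q t y"
proof -
  have "at y within {0..1} \<noteq> bot" using assms by (simp add: trivial_limit_within islimpt_Icc)
  moreover have "((\<lambda>z. (Q t z - Q t y) / (z - y)) \<longlongrightarrow> q t y) (at y within {0..1})"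
    using Q_eta_derivative[OF assms] by (simp add: has_field_derivative_iff)
  moreover have "eventually (\<lambda>z. 0 \<le> (Q t z - Q t y) / (z - y)) (at y within {0..1})"
    unfolding eventually_at_filter
  proof (intro always_eventually allI impI)
    fix z assume "z \<noteq> y" "z \<in> {0..1::real}"
    then show "0 \<le> (Q t z - Q t y) / (z - y)"
      using Q_mono[OF assms(1)] assms(2) unfolding monotone_on_def
      by (cases "z \<le> y") (auto intro: divide_nonneg_nonneg divide_nonpos_nonpos)
  qed
  ultimately show ?thesis by (metis tendsto_lowerbound)
qed

text \<open>
At \<open>\<eta> = 0\<close> the time derivative of \<open>Q\<close> vanishes, and the equation becomes \<open>q = 1/N + K(0)\<close>.  The
jump of \<open>q\<close> between the two ends is therefore the same for all solutions.
\<close>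

lemma q_boundary:
  assumes "t \<in> time_dom T"
  shows "q t 0 = q t 1 - K \<Phi> + K 0"
proof -
  have "((\<lambda>t. Q t 0) has_real_derivative 1 / N t + K (Q t 0) - q t 0) (at t within time_dom T)"
    using Q_tau_derivative[OF assms, of 0] by simp
  moreover have "((\<lambda>t. Q t 0) has_real_derivative 0) (at t within time_dom T)"
    by (rule has_field_derivative_transform_within[of "\<lambda>_. 0" 0 t "time_dom T" 1])
      (use assms Q_at_0 in auto)
  ultimately have "1 / N t + K (Q t 0) - q t 0 = 0"
    using at_within_time_dom_neq_bot[OF assms]
    by (metis has_real_derivative_iff_has_vector_derivative vector_derivative_within)
  then show ?thesis using flux[OF assms] Q_at_0[OF assms] by simp
qed

text \<open>
Since \<open>Q\<close> is only \<open>C\<^sup>1\<close>, the equation cannot be differentiated in \<open>\<eta>\<close> directly.  Instead, the equation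
for \<open>Q\<close> is integrated along the characteristics that start at time \<open>a\<close> from a variable point \<open>y\<close>,
and the integrated form is differentiated in \<open>y\<close>, which removes \<open>1/N\<close>.  The admissible starting
points form the interval \<open>[0, 1 - (b - a)]\<close>; it is nondegenerate because \<open>b < a + 1\<close>, so that
derivatives relative to it are unique.
\<close>

lemma q_along_characteristic:
  assumes ab: "0 \<le> a" "b \<le> \<tau>" "b < a + 1" and x: "0 \<le> x" "x + (b - a) \<le> 1" and r: "r \<in> {a..b}"
  shows "((\<lambda>r. q r (x + (r - a))) has_real_derivative
      deriv K (Q r (x + (r - a))) * q r (x + (r - a))) (at r within {a..b})"
proof -
  have ran: "t \<in> time_dom T" "y + (t - a) \<in> {0..1}"
    if "t \<in> {a..b}" "y \<in> {0..1 - (b - a)}" for t y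
    using that ab time by auto
  define G where "G y t = deriv K (Q t (y + (t - a))) * q t (y + (t - a))" for y t
  have contQ: "continuous_on {a..b} (\<lambda>t. Q t (y + (t - a)))"
    and contq: "continuous_on {a..b} (\<lambda>t. q t (y + (t - a)))"
    if "y \<in> {0..1 - (b - a)}" for y
  proof -
    have c: "continuous_on {a..b} (\<lambda>t. t)" "continuous_on {a..b} (\<lambda>t. y + (t - a))"
      by (intro continuous_intros)+
    show "continuous_on {a..b} (\<lambda>t. Q t (y + (t - a)))"
      by (rule continuous_on_compose_Pair[OF continuous_on_Q c]) (use ran that in blast)+
    show "continuous_on {a..b} (\<lambda>t. q t (y + (t - a)))"
      by (rule continuous_on_compose_Pair[OF continuous_on_q c]) (use ran that in blast)+
  qed
  have contG: "continuous_on {a..b} (G y)" if "y \<in> {0..1 - (b - a)}" for y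
    unfolding G_def
    by (rule continuous_on_mult[OF continuous_on_compose_K(2)[OF K contQ[OF that]] contq[OF that]])
  have eq: "q c (x + (c - a)) = q a x + integral {a..c} (G x)" if c: "c \<in> {a..b}" for c
  proof -
    define Y where "Y = {0..1 - (b - a)}"
    define H where "H y t = 1 / N t + K (Q t (y + (t - a)))" for y t
    have ranc: "t \<in> time_dom T" "y + (t - a) \<in> {0..1}" if "t \<in> {a..c}" "y \<in> Y" for t y
      using that c ran unfolding Y_def by auto
    have contH: "continuous_on {a..c} (H y)" if y: "y \<in> Y" for y
    proof -
      have yab: "y \<in> {0..1 - (b - a)}" and sub: "{a..c} \<subseteq> {a..b}" using y c by (auto simp: Y_def)
      have "continuous_on {a..c} (\<lambda>t. q t 1)"
        by (rule continuous_on_compose_Pair[OF continuous_on_q continuous_on_id continuous_on_const])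
          (use ranc(1)[OF _ y] in auto)
      then have "continuous_on {a..c} (\<lambda>t. q t 1 - K \<Phi> + K (Q t (y + (t - a))))"
        by (intro continuous_on_add continuous_on_diff continuous_on_const
            continuous_on_compose_K(1)[OF K continuous_on_subset[OF contQ[OF yab] sub]])
      then show ?thesis
        by (rule continuous_on_eq) (simp add: H_def flux[OF ranc(1)[OF _ y]])
    qed
    have integrated: "Q c (y + (c - a)) - Q a y = integral {a..c} (H y)" if y: "y \<in> Y" for y
    proof -
      have "(H y has_integral (Q c (y + (c - a)) - Q a (y + (a - a)))) {a..c}"
      proof (rule fundamental_theorem_of_calculus)
        show "a \<le> c" using c by simp
        fix t assume t: "t \<in> {a..c}"
        have "((\<lambda>t. Q t (y + (t - a))) has_real_derivative
            (1 * (1 / N t + K (Q t (y + (t - a)))) + (1 - 1) * q t (y + (t - a)))) (at t within {a..c})"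
          by (rule Q_along_curve)
            (use ranc y t in \<open>auto intro!: derivative_eq_intros\<close>)
        then show "((\<lambda>t. Q t (y + (t - a))) has_vector_derivative H y t) (at t within {a..c})"
          by (simp add: H_def has_real_derivative_iff_has_vector_derivative)
      qed
      then show ?thesis by (simp add: integral_unique)
    qed
    have xY: "x \<in> Y" using x by (auto simp: Y_def)
    have lhs: "((\<lambda>y. Q c (y + (c - a)) - Q a y) has_real_derivative q c (x + (c - a)) - q a x) (at x within Y)"
    proof (rule DERIV_diff)
      have "((\<lambda>y. Q c (y + (c - a))) has_real_derivative
          (0 * (1 / N c + K (Q c (x + (c - a)))) + (1 - 0) * q c (x + (c - a)))) (at x within Y)"
        by (rule Q_along_curve) (use ranc xY c in \<open>auto intro!: derivative_eq_intros\<close>)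
      then show "((\<lambda>y. Q c (y + (c - a))) has_real_derivative q c (x + (c - a))) (at x within Y)" by simp
      have "Y \<subseteq> {0..1}" using c by (auto simp: Y_def)
      then show "(Q a has_real_derivative q a x) (at x within Y)"
        using xY ranc[of a x] c by (intro DERIV_subset[OF Q_eta_derivative]) auto
    qed
    have "((\<lambda>y. integral (cbox a c) (H y)) has_real_derivative integral (cbox a c) (G x)) (at x within Y)"
    proof (rule leibniz_rule_field_derivative)
      show "x \<in> Y" "convex Y" using xY by (simp_all add: Y_def)
      show "H y integrable_on cbox a c" if "y \<in> Y" for y
        using contH[OF that] by (simp add: integrable_continuous_real)
      show "((\<lambda>y. H y t) has_real_derivative G y t) (at y within Y)" if "y \<in> Y" "t \<in> cbox a c" for y t
      proof -
        have "((\<lambda>y. Q t (y + (t - a))) has_real_derivative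
            (0 * (1 / N t + K (Q t (y + (t - a)))) + (1 - 0) * q t (y + (t - a)))) (at y within Y)"
          by (rule Q_along_curve) (use ranc that in \<open>auto intro!: derivative_eq_intros\<close>)
        then have "((\<lambda>y. Q t (y + (t - a))) has_real_derivative q t (y + (t - a))) (at y within Y)" by simp
        from DERIV_add[OF DERIV_const DERIV_chain2[OF standing_assumptionsD(2)[OF K] this]]
        show ?thesis by (simp add: H_def G_def)
      qed
      have 1: "continuous_on (Y \<times> cbox a c) (\<lambda>z. q (snd z) (fst z + (snd z - a)))"
        by (rule continuous_on_compose_Pair[OF continuous_on_q])
          (use ranc in \<open>auto intro!: continuous_intros\<close>)
      have 2: "continuous_on (Y \<times> cbox a c) (\<lambda>z. Q (snd z) (fst z + (snd z - a)))"
        by (rule continuous_on_compose_Pair[OF continuous_on_Q])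
          (use ranc in \<open>auto intro!: continuous_intros\<close>)
      show "continuous_on (Y \<times> cbox a c) (\<lambda>(y, t). G y t)"
        unfolding G_def split_beta
        by (rule continuous_on_mult[OF continuous_on_compose_K(2)[OF K 2] 1])
    qed
    then have "((\<lambda>y. integral {a..c} (H y)) has_real_derivative integral {a..c} (G x)) (at x within Y)"
      by simp
    then have "((\<lambda>y. Q c (y + (c - a)) - Q a y) has_real_derivative integral {a..c} (G x)) (at x within Y)"
      by (rule has_field_derivative_transform_within[OF _ zero_less_one xY]) (simp add: integrated)
    with lhs have "q c (x + (c - a)) - q a x = integral {a..c} (G x)"
      using vector_derivative_unique_within_closed_interval[of 0 "1 - (b - a)" x] ab xY
      by (simp add: Y_def has_real_derivative_iff_has_vector_derivative)
    then show ?thesis by simp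
  qed
  have "((\<lambda>c. q a x + integral {a..c} (G x)) has_real_derivative 0 + G x r) (at r within {a..b})"
    by (intro DERIV_add DERIV_const integral_has_real_derivative contG r) (use x in auto)
  then have "((\<lambda>c. q a x + integral {a..c} (G x)) has_real_derivative G x r) (at r within {a..b})" by simp
  then have "((\<lambda>c. q c (x + (c - a))) has_real_derivative G x r) (at r within {a..b})"
    by (rule has_field_derivative_transform_within[OF _ zero_less_one r]) (simp add: eq)
  then show ?thesis by (simp add: G_def)
qed

end

section \<open>The \<open>L\<^sup>1\<close> estimate\<close>

lemma L1_norm_eq_integral:
  assumes f: "continuous_on {0..1} f"
  shows "L1_norm f = integral {0..1} (\<lambda>x. \<bar>f x\<bar>)"
proof -
  have "set_integrable lborel {0..1} (\<lambda>x. \<bar>f x\<bar>)"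
    by (intro borel_integrable_atLeastAtMost' continuous_on_rabs f)
  then have "set_integrable lborel {0<..<1} (\<lambda>x. \<bar>f x\<bar>)"
    by (rule set_integrable_subset) auto
  then have "L1_norm f = integral {0<..<1} (\<lambda>x. \<bar>f x\<bar>)"
    unfolding L1_norm_def by (rule set_borel_integral_eq_integral(2))
  then show ?thesis by (simp add: integral_open_interval_real)
qed

theorem theorem4p1:
  fixes K :: "real \<Rightarrow> real" and \<Phi>F :: real
    and T1 T2 :: ereal
    and Qinit1 Qinit2 :: "real \<Rightarrow> real"
    and Q1 Q2 :: "real \<Rightarrow> real \<Rightarrow> real"
    and N1 N2 :: "real \<Rightarrow> real"
    and \<tau> :: real
  assumes "standing_assumptions K \<Phi>F"
    and "classical_solution K \<Phi>F T1 Qinit1 Q1 N1"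
    and "classical_solution K \<Phi>F T2 Qinit2 Q2 N2"
    and "0 \<le> \<tau>" and "ereal \<tau> < T1" and "ereal \<tau> < T2"
  shows "exp (k_min K \<Phi>F * \<tau>) * L1_norm (\<lambda>\<eta>. d_eta Q1 0 \<eta> - d_eta Q2 0 \<eta>)
           \<le> L1_norm (\<lambda>\<eta>. d_eta Q1 \<tau> \<eta> - d_eta Q2 \<tau> \<eta>)
       \<and> L1_norm (\<lambda>\<eta>. d_eta Q1 \<tau> \<eta> - d_eta Q2 \<tau> \<eta>)
           \<le> exp (k_max K \<Phi>F * \<tau>) * L1_norm (\<lambda>\<eta>. d_eta Q1 0 \<eta> - d_eta Q2 0 \<eta>)"
proof -
  interpret s1: solution K \<Phi>F T1 Qinit1 Q1 N1 \<tau> using assms by unfold_locales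
  interpret s2: solution K \<Phi>F T2 Qinit2 Q2 N2 \<tau> using assms by unfold_locales
  define w where "w r x = d_eta Q1 r x - d_eta Q2 r x" for r x
  define g where "g r x = deriv K (Q1 r x) * d_eta Q1 r x - deriv K (Q2 r x) * d_eta Q2 r x" for r x
  have sub: "{0..\<tau>} \<times> {0..1} \<subseteq> time_dom T1 \<times> {0..1::real}" "{0..\<tau>} \<times> {0..1} \<subseteq> time_dom T2 \<times> {0..1::real}"
    using s1.time s2.time by blast+
  note cont = continuous_on_subset[OF s1.continuous_on_Q sub(1), unfolded split_beta]
    continuous_on_subset[OF s2.continuous_on_Q sub(2), unfolded split_beta]
    continuous_on_subset[OF s1.continuous_on_q sub(1), unfolded split_beta]
    continuous_on_subset[OF s2.continuous_on_q sub(2), unfolded split_beta]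
  have contw: "continuous_on ({0..\<tau>} \<times> {0..1}) (\<lambda>(r, x). w r x)"
    unfolding w_def split_beta by (rule continuous_on_diff[OF cont(3,4)])
  have contg: "continuous_on ({0..\<tau>} \<times> {0..1}) (\<lambda>(r, x). g r x)"
    unfolding g_def split_beta
    by (intro continuous_on_diff continuous_on_mult continuous_on_compose_K(2)[OF assms(1)] cont)
  have slice1: "continuous_on {0..1} (d_eta Q1 r)" and slice2: "continuous_on {0..1} (d_eta Q2 r)"
    if "r \<in> {0..\<tau>}" for r
    using continuous_on_compose_Pair[OF s1.continuous_on_q continuous_on_const[of _ r] continuous_on_id]
      continuous_on_compose_Pair[OF s2.continuous_on_q continuous_on_const[of _ r] continuous_on_id]
      s1.time[OF that] s2.time[OF that] by blast+
  have per: "w r 0 = w r 1" if "r \<in> {0..\<tau>}" for r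
    using s1.q_boundary[OF s1.time[OF that]] s2.q_boundary[OF s2.time[OF that]] by (simp add: w_def)
  have char: "((\<lambda>r. w r (x + (r - a))) has_real_derivative g r (x + (r - a))) (at r within {a..b})"
    if "0 \<le> a" "b \<le> \<tau>" "b \<le> a + 1 / 2" "0 \<le> x" "x + (b - a) \<le> 1" "r \<in> {a..b}" for a b x r
    unfolding w_def g_def
    by (intro DERIV_diff s1.q_along_characteristic s2.q_along_characteristic) (use that in auto)
  have growth: "k_min K \<Phi>F * integral {0..1} (\<lambda>x. \<bar>w r x\<bar>) \<le> integral {0..1} (\<lambda>x. sgn (w r x) * g r x)"
      "integral {0..1} (\<lambda>x. sgn (w r x) * g r x) \<le> k_max K \<Phi>F * integral {0..1} (\<lambda>x. \<bar>w r x\<bar>)"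
    if r: "r \<in> {0..\<tau>}" for r
  proof -
    have ends: "Q1 r 0 = Q2 r 0" "Q1 r 1 = Q2 r 1"
      using s1.Q_at_0 s2.Q_at_0 s1.Q_at_1 s2.Q_at_1 s1.time s2.time r by auto
    note bounds = integral_sgn_growth_bounds[OF assms(1) zero_le_one
        s1.Q_eta_derivative[OF s1.time[OF r]] s2.Q_eta_derivative[OF s2.time[OF r]]
        slice1[OF r] slice2[OF r]
        s1.q_nonneg[OF s1.time[OF r]] s2.q_nonneg[OF s2.time[OF r]]
        s1.Q_range[OF r] s2.Q_range[OF r] ends]
    show "k_min K \<Phi>F * integral {0..1} (\<lambda>x. \<bar>w r x\<bar>) \<le> integral {0..1} (\<lambda>x. sgn (w r x) * g r x)"
      unfolding w_def g_def by (rule bounds(1))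
    show "integral {0..1} (\<lambda>x. sgn (w r x) * g r x) \<le> k_max K \<Phi>F * integral {0..1} (\<lambda>x. \<bar>w r x\<bar>)"
      unfolding w_def g_def by (rule bounds(2))
  qed
  \<comment> \<open>Any length strictly between 0 and 1 would do: characteristics are only controlled for
    durations below 1.\<close>
  have half: "0 < (1 / 2 :: real)" "1 / 2 \<le> (1 :: real)" by simp_all
  have norm: "L1_norm (\<lambda>\<eta>. d_eta Q1 r \<eta> - d_eta Q2 r \<eta>) = integral {0..1} (\<lambda>x. \<bar>w r x\<bar>)"
    if "r \<in> {0..\<tau>}" for r
    unfolding w_def by (rule L1_norm_eq_integral[OF continuous_on_diff[OF slice1[OF that] slice2[OF that]]])
  have ends: "0 \<in> {0..\<tau>}" "\<tau> \<in> {0..\<tau>}" using assms(4) by auto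
  show ?thesis
    unfolding norm[OF ends(1)] norm[OF ends(2)]
    using transport_L1_exp_bounds[OF assms(4) half contw contg per char growth] by blast
qed

end
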